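(* Let $f:[0,\infty)\to[0,\infty)$ be a monotonic function with $\lambda_t f\to\infty$ as $t\to\infty$. Put $X_k=S_k-S_{k-1}$ (which are i.i.d. exponential with mean 1), $w_k=f(k)$ and $W_n=\sum_{k=1}^n w_k$. Fix a mode of convergence: almost sure, in probability, or in $L^p$ for some $0<p<\infty$. Then $$\frac{S_t f}{\lambda_t f}\to 1 \ \text{ as } t\to\infty \text{ (real } t)\text{ in this mode}$$ if and only if $$\frac{\sum_{k=1}^n w_kX_k}{W_n}\to 1\ \text{ as } n\to\infty \text{ in the same mode}.$$
   Context: $(S_t)_{t\ge 0}$ is the standard Gamma process: the increasing (right-continuous) Lévy process with $S_0=0$ and $\mathbb{E}e^{-\theta S_t}=(1+\theta)^{-t}$ for $\theta\ge 0$ (so $S_1$ is exponential with mean 1). For a measurable locally integrable $f\ge 0$ put $\lambda_t f=\int_0^t f(x)\,dx$ and $S_t f=\int_0^t f\,dS$ (pathwise integral over $(0,t]$; it is a.s. finite, $\mathbb{E}\,S_tf=\lambda_t f$, and $-\ln \mathbb{E}e^{-\theta S_t f}=\int_0^t\ln(1+\theta f(x))\,dx$ for $\theta\ge0$). "Monotonic" means increasing or decreasing, not necessarily strictly. Quotients are considered for $t$ or $n$ large enough that the denominators are positive. *)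

theory Defs
  imports "HOL-Probability.Probability"
begin

text \<open>
  Processes are indexed by all reals, but only times \<open>t \<ge> 0\<close> are constrained. The path properties
  hold for every \<open>\<omega>\<close> in the sample space, so that pathwise Stieltjes integrals are defined everywhere.
  Stochastic continuity is a consequence of the path regularity and stationarity.
\<close>

locale levy_process = prob_space M for M :: "'a measure" +
  fixes S :: "real \<Rightarrow> 'a \<Rightarrow> real"
  assumes random_variable: "\<And>t. 0 \<le> t \<Longrightarrow> S t \<in> borel_measurable M"
    and start: "\<And>\<omega>. \<omega> \<in> space M \<Longrightarrow> S 0 \<omega> = 0"
    and indep_increments:
      "\<And>(n :: nat) (\<tau> :: nat \<Rightarrow> real). 0 \<le> \<tau> 0 \<Longrightarrow> mono_on {..n} \<tau> \<Longrightarrow>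
         indep_vars (\<lambda>_. borel) (\<lambda>i \<omega>. S (\<tau> (Suc i)) \<omega> - S (\<tau> i) \<omega>) {..<n}"
    and stationary_increments:
      "\<And>s h. 0 \<le> s \<Longrightarrow> 0 \<le> h \<Longrightarrow>
         distr M borel (\<lambda>\<omega>. S (s + h) \<omega> - S s \<omega>) = distr M borel (S h)"
    and right_continuous:
      "\<And>\<omega> t. \<omega> \<in> space M \<Longrightarrow> 0 \<le> t \<Longrightarrow> continuous (at_right t) (\<lambda>s. S s \<omega>)"
    and left_limits:
      "\<And>\<omega> t. \<omega> \<in> space M \<Longrightarrow> 0 < t \<Longrightarrow> \<exists>l. ((\<lambda>s. S s \<omega>) \<longlongrightarrow> l) (at_left t)"

locale gamma_process = levy_process +
  assumes increasing: "\<And>\<omega>. \<omega> \<in> space M \<Longrightarrow> mono_on {0..} (\<lambda>t. S t \<omega>)"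
    and laplace_transform:
      "\<And>t \<theta>. 0 \<le> t \<Longrightarrow> 0 \<le> \<theta> \<Longrightarrow> expectation (\<lambda>\<omega>. exp (- \<theta> * S t \<omega>)) = (1 + \<theta>) powr (- t)"

definition lebesgue_int :: "(real \<Rightarrow> real) \<Rightarrow> real \<Rightarrow> real" where
  "lebesgue_int f t = (LINT x:{0..t}|lborel. f x)"

text \<open>
  The path is extended to negative times by its value at \<open>0\<close>, because \<^const>\<open>interval_measure\<close> needs
  a nondecreasing right-continuous function on the whole real line.
\<close>

definition stieltjes_int :: "(real \<Rightarrow> 'a \<Rightarrow> real) \<Rightarrow> (real \<Rightarrow> real) \<Rightarrow> real \<Rightarrow> 'a \<Rightarrow> real" where
  "stieltjes_int S f t \<omega> = (LINT x:{0<..t}|interval_measure (\<lambda>s. S (max 0 s) \<omega>). f x)"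

definition converges_AE ::
    "'a measure \<Rightarrow> ('i \<Rightarrow> 'a \<Rightarrow> real) \<Rightarrow> real \<Rightarrow> 'i filter \<Rightarrow> bool" where
  "converges_AE M Y c F \<longleftrightarrow> (AE \<omega> in M. ((\<lambda>i. Y i \<omega>) \<longlongrightarrow> c) F)"

definition converges_in_prob ::
    "'a measure \<Rightarrow> ('i \<Rightarrow> 'a \<Rightarrow> real) \<Rightarrow> real \<Rightarrow> 'i filter \<Rightarrow> bool" where
  "converges_in_prob M Y c F \<longleftrightarrow>
     (\<forall>\<epsilon>>0. ((\<lambda>i. measure M {\<omega> \<in> space M. \<bar>Y i \<omega> - c\<bar> > \<epsilon>}) \<longlongrightarrow> 0) F)"

text \<open>
  The extended nonnegative integral is used since the Bochner integral of a non-integrable function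
  is \<open>0\<close>. Values of \<open>p\<close> below \<open>1\<close> are allowed.
\<close>

definition converges_Lp ::
    "real \<Rightarrow> 'a measure \<Rightarrow> ('i \<Rightarrow> 'a \<Rightarrow> real) \<Rightarrow> real \<Rightarrow> 'i filter \<Rightarrow> bool" where
  "converges_Lp p M Y c F \<longleftrightarrow>
     ((\<lambda>i. \<integral>\<^sup>+\<omega>. ennreal (\<bar>Y i \<omega> - c\<bar> powr p) \<partial>M) \<longlongrightarrow> 0) F"

end

theory Submission
  imports Defs
begin

text \<open>
  Suppose \<open>f\<close> increases, and write \<open>A\<close>, \<open>\<lambda>\<close> for the stochastic and the deterministic integral,
  \<open>B\<^sub>n\<close> for the weighted sum and \<open>B'\<^sub>n = \<Sum>k\<le>n. w\<^sub>k X\<^sub>k\<^sub>+\<^sub>1\<close>. Riemann sums with unit steps give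
  \<open>B'\<^sub>n\<^sub>-\<^sub>1 \<le> A\<^sub>n \<le> B\<^sub>n\<close>, and \<open>B'\<close> has the same law as \<open>B\<close> as a sequence. Splitting convergence to \<open>1\<close> into
  an upper and a lower half, each half passes between \<open>A\<close> and \<open>B\<close>, directly or through \<open>B'\<close>,
  provided that the normalisers satisfy \<open>\<lambda>\<^sub>n\<^sub>+\<^sub>1 / \<lambda>\<^sub>n \<rightarrow> 1\<close> and \<open>W\<^sub>n / \<lambda>\<^sub>n \<rightarrow> 1\<close>. This is forced by either
  convergence: if an increment carried a nonvanishing proportion of the normaliser, its quotient by
  its mean would be close to \<open>1\<close> in probability, whereas \<open>E exp (- D / E D) \<ge> 1 / 2 > exp (- 1)\<close> for
  every increment \<open>D\<close> of \<open>A\<close> over a unit interval or of \<open>B\<close>. If \<open>f\<close> decreases, the inequalities are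
  reversed up to the error \<open>f 0 * X\<^sub>1\<close>, and the normalisers are equivalent because their increments
  are bounded.
\<close>

section \<open>Modes of convergence\<close>

text \<open>One datatype for the three modes allows each argument to be made once. Case distinctions
  on the mode occur only in lemmas about general random variables, never in those about the Gamma
  process.\<close>

datatype mode = Almost_Surely | In_Prob | In_Lp real

fun valid_mode :: "mode \<Rightarrow> bool" where
  "valid_mode (In_Lp p) \<longleftrightarrow> 0 < p"
| "valid_mode _ \<longleftrightarrow> True"

fun converges :: "mode \<Rightarrow> 'a measure \<Rightarrow> ('i \<Rightarrow> 'a \<Rightarrow> real) \<Rightarrow> real \<Rightarrow> 'i filter \<Rightarrow> bool" where
  "converges Almost_Surely = converges_AE"
| "converges In_Prob = converges_in_prob"
| "converges (In_Lp p) = converges_Lp p"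

abbreviation vanishes :: "mode \<Rightarrow> 'a measure \<Rightarrow> ('i \<Rightarrow> 'a \<Rightarrow> real) \<Rightarrow> 'i filter \<Rightarrow> bool" where
  "vanishes m M Z F \<equiv> converges m M Z 0 F"

lemma converges_iff_vanishes:
  "converges m M Y c F \<longleftrightarrow> vanishes m M (\<lambda>i \<omega>. Y i \<omega> - c) F"
  by (cases m)
     (simp_all add: converges_AE_def converges_in_prob_def converges_Lp_def LIM_zero_iff)

text \<open>Serves for restricting real times to integers, for lifting a sequence to real times
  through the floor, and for shifts of the index.\<close>

lemma converges_compose:
  assumes "converges m M Y c F" "filterlim h F G"
  shows "converges m M (\<lambda>i. Y (h i)) c G"
proof (cases m)
  case Almost_Surely
  with assms show ?thesis
    by (auto simp: converges_AE_def intro: filterlim_compose elim!: eventually_mono)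
next
  case In_Prob
  with assms show ?thesis
    by (auto simp: converges_in_prob_def
        intro: filterlim_compose[where g="\<lambda>i. measure M {\<omega> \<in> space M. _ < \<bar>Y i \<omega> - c\<bar>}"])
next
  case (In_Lp p)
  with assms show ?thesis
    by (auto simp: converges_Lp_def
        intro: filterlim_compose[where g="\<lambda>i. \<integral>\<^sup>+\<omega>. ennreal (\<bar>Y i \<omega> - c\<bar> powr p) \<partial>M"])
qed

section \<open>Closure properties and comparison of the modes\<close>

lemma tendsto_0_ennreal_cmult:
  fixes c :: real and u :: "'i \<Rightarrow> ennreal"
  assumes "(u \<longlongrightarrow> 0) F" "0 \<le> c"
  shows "((\<lambda>i. ennreal c * u i) \<longlongrightarrow> 0) F"
  using ennreal_tendsto_cmult[of "ennreal c" u 0 F] assms by simp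

text \<open>Monotonicity of events and of integrals does the work. Measurability of \<open>U\<close>
  makes its exceedance events measurable and lets the constant be taken out of its integral.\<close>

lemma vanishes_dominated:
  assumes m: "valid_mode m" and fin: "finite_measure M" and U: "vanishes m M U F"
    and meas: "\<forall>\<^sub>F i in F. U i \<in> borel_measurable M"
    and le: "\<forall>\<^sub>F i in F. \<forall>\<omega>\<in>space M. \<bar>Z i \<omega>\<bar> \<le> C * \<bar>U i \<omega>\<bar>"
  shows "vanishes m M Z F"
proof -
  interpret finite_measure M by fact
  \<comment> \<open>A constant of at least \<open>1\<close> keeps the bound and may be divided
    by.\<close>
  define D where "D = max C 1"
  have D: "D > 0" by (simp add: D_def)
  have le: "\<forall>\<^sub>F i in F. \<forall>\<omega>\<in>space M. \<bar>Z i \<omega>\<bar> \<le> D * \<bar>U i \<omega>\<bar>"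
    using le
  proof (eventually_elim, safe)
    fix i \<omega> assume *: "\<forall>\<omega>\<in>space M. \<bar>Z i \<omega>\<bar> \<le> C * \<bar>U i \<omega>\<bar>" "\<omega> \<in> space M"
    have "C * \<bar>U i \<omega>\<bar> \<le> D * \<bar>U i \<omega>\<bar>" by (intro mult_right_mono) (auto simp: D_def)
    with * show "\<bar>Z i \<omega>\<bar> \<le> D * \<bar>U i \<omega>\<bar>" by force
  qed
  show ?thesis
  proof (cases m)
    case Almost_Surely
    with U have "AE \<omega> in M. ((\<lambda>i. U i \<omega>) \<longlongrightarrow> 0) F" by (simp add: converges_AE_def)
    then have "AE \<omega> in M. ((\<lambda>i. Z i \<omega>) \<longlongrightarrow> 0) F"
    proof (rule AE_mp, intro AE_I2 impI)
      fix \<omega> assume \<omega>: "\<omega> \<in> space M" and lim: "((\<lambda>i. U i \<omega>) \<longlongrightarrow> 0) F"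
      have "((\<lambda>i. D * \<bar>U i \<omega>\<bar>) \<longlongrightarrow> 0) F" by (intro tendsto_mult_right_zero tendsto_rabs_zero lim)
      moreover have "\<forall>\<^sub>F i in F. norm (Z i \<omega>) \<le> D * \<bar>U i \<omega>\<bar>"
        using le by eventually_elim (use \<omega> in auto)
      ultimately show "((\<lambda>i. Z i \<omega>) \<longlongrightarrow> 0) F" by (rule Lim_null_comparison[rotated])
    qed
    then show ?thesis using Almost_Surely by (simp add: converges_AE_def)
  next
    case In_Prob
    have "((\<lambda>i. measure M {\<omega> \<in> space M. \<bar>Z i \<omega>\<bar> > \<epsilon>}) \<longlongrightarrow> 0) F" if "\<epsilon> > 0" for \<epsilon>
    proof (rule Lim_null_comparison)
      show "((\<lambda>i. measure M {\<omega> \<in> space M. \<bar>U i \<omega>\<bar> > \<epsilon> / D}) \<longlongrightarrow> 0) F"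
        using U In_Prob divide_pos_pos[OF \<open>\<epsilon> > 0\<close> D] by (simp add: converges_in_prob_def)
      show "\<forall>\<^sub>F i in F. norm (measure M {\<omega> \<in> space M. \<bar>Z i \<omega>\<bar> > \<epsilon>})
          \<le> measure M {\<omega> \<in> space M. \<bar>U i \<omega>\<bar> > \<epsilon> / D}"
        using le meas
      proof eventually_elim
        case (elim i)
        note [measurable] = elim(2)
        have "{\<omega> \<in> space M. \<bar>Z i \<omega>\<bar> > \<epsilon>} \<subseteq> {\<omega> \<in> space M. \<bar>U i \<omega>\<bar> > \<epsilon> / D}"
          using elim(1) D by (fastforce simp: field_simps)
        then show ?case by (simp add: finite_measure_mono)
      qed
    qed
    then show ?thesis using In_Prob by (simp add: converges_in_prob_def)
  next
    case (In_Lp p)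
    with m have p: "p > 0" by simp
    have "((\<lambda>i. \<integral>\<^sup>+\<omega>. ennreal (\<bar>Z i \<omega>\<bar> powr p) \<partial>M) \<longlongrightarrow> 0) F"
    proof (rule tendsto_sandwich[where f="\<lambda>_. 0"])
      show "((\<lambda>i. ennreal (D powr p) * (\<integral>\<^sup>+\<omega>. ennreal (\<bar>U i \<omega>\<bar> powr p) \<partial>M)) \<longlongrightarrow> 0) F"
        using U In_Lp by (intro tendsto_0_ennreal_cmult) (auto simp: converges_Lp_def)
      show "\<forall>\<^sub>F i in F. (\<integral>\<^sup>+\<omega>. ennreal (\<bar>Z i \<omega>\<bar> powr p) \<partial>M)
          \<le> ennreal (D powr p) * (\<integral>\<^sup>+\<omega>. ennreal (\<bar>U i \<omega>\<bar> powr p) \<partial>M)"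
        using le meas
      proof eventually_elim
        case (elim i)
        note [measurable] = elim(2)
        have "(\<integral>\<^sup>+\<omega>. ennreal (\<bar>Z i \<omega>\<bar> powr p) \<partial>M)
            \<le> (\<integral>\<^sup>+\<omega>. ennreal (D powr p) * ennreal (\<bar>U i \<omega>\<bar> powr p) \<partial>M)"
          using elim(1) D p
          by (intro nn_integral_mono)
             (auto simp: ennreal_mult[symmetric] powr_mult[symmetric] intro!: ennreal_leI powr_mono2)
        also have "\<dots> = ennreal (D powr p) * (\<integral>\<^sup>+\<omega>. ennreal (\<bar>U i \<omega>\<bar> powr p) \<partial>M)"
          by (rule nn_integral_cmult) measurable
        finally show ?case .
      qed
    qed auto
    then show ?thesis using In_Lp by (simp add: converges_Lp_def)
  qed
qed

text \<open>A sum is at most twice its larger summand. Unlike Minkowski's inequality, this also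
  covers exponents below \<open>1\<close>.\<close>

lemma powr_add_le:
  fixes a b p :: real
  assumes "0 \<le> a" "0 \<le> b" "0 < p"
  shows "(a + b) powr p \<le> 2 powr p * (a powr p + b powr p)"
proof -
  have "(a + b) powr p \<le> (2 * max a b) powr p" using assms by (intro powr_mono2) auto
  also have "\<dots> = 2 powr p * max a b powr p" using assms by (simp add: powr_mult)
  also have "\<dots> \<le> 2 powr p * (a powr p + b powr p)" by (intro mult_left_mono) (auto simp: max_def)
  finally show ?thesis .
qed

lemma vanishes_add:
  assumes m: "valid_mode m" and fin: "finite_measure M"
    and U: "vanishes m M U F" "\<forall>\<^sub>F i in F. U i \<in> borel_measurable M"
    and V: "vanishes m M V F" "\<forall>\<^sub>F i in F. V i \<in> borel_measurable M"
  shows "vanishes m M (\<lambda>i \<omega>. U i \<omega> + V i \<omega>) F"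
proof -
  interpret finite_measure M by fact
  show ?thesis
  proof (cases m)
    case Almost_Surely
    have "AE \<omega> in M. ((\<lambda>i. U i \<omega>) \<longlongrightarrow> 0) F" "AE \<omega> in M. ((\<lambda>i. V i \<omega>) \<longlongrightarrow> 0) F"
      using U V Almost_Surely by (simp_all add: converges_AE_def)
    then have "AE \<omega> in M. ((\<lambda>i. U i \<omega> + V i \<omega>) \<longlongrightarrow> 0) F"
      by eventually_elim (rule tendsto_add_zero)
    then show ?thesis using Almost_Surely by (simp add: converges_AE_def)
  next
    case In_Prob
    have "((\<lambda>i. measure M {\<omega> \<in> space M. \<bar>U i \<omega> + V i \<omega>\<bar> > \<epsilon>}) \<longlongrightarrow> 0) F" if "\<epsilon> > 0" for \<epsilon>
    proof (rule Lim_null_comparison)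
      show "((\<lambda>i. measure M {\<omega> \<in> space M. \<bar>U i \<omega>\<bar> > \<epsilon> / 2}
                + measure M {\<omega> \<in> space M. \<bar>V i \<omega>\<bar> > \<epsilon> / 2}) \<longlongrightarrow> 0) F"
        using U V In_Prob half_gt_zero[OF \<open>\<epsilon> > 0\<close>]
        by (intro tendsto_add_zero) (simp_all only: converges.simps converges_in_prob_def diff_0_right)
      show "\<forall>\<^sub>F i in F. norm (measure M {\<omega> \<in> space M. \<bar>U i \<omega> + V i \<omega>\<bar> > \<epsilon>})
          \<le> measure M {\<omega> \<in> space M. \<bar>U i \<omega>\<bar> > \<epsilon> / 2} + measure M {\<omega> \<in> space M. \<bar>V i \<omega>\<bar> > \<epsilon> / 2}"
        using U(2) V(2)
      proof eventually_elim
        case (elim i)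
        note [measurable] = elim
        have "{\<omega> \<in> space M. \<bar>U i \<omega> + V i \<omega>\<bar> > \<epsilon>}
            \<subseteq> {\<omega> \<in> space M. \<bar>U i \<omega>\<bar> > \<epsilon> / 2} \<union> {\<omega> \<in> space M. \<bar>V i \<omega>\<bar> > \<epsilon> / 2}"
          by auto
        then have "measure M {\<omega> \<in> space M. \<bar>U i \<omega> + V i \<omega>\<bar> > \<epsilon>}
            \<le> measure M ({\<omega> \<in> space M. \<bar>U i \<omega>\<bar> > \<epsilon> / 2} \<union> {\<omega> \<in> space M. \<bar>V i \<omega>\<bar> > \<epsilon> / 2})"
          by (intro finite_measure_mono) auto
        also have "\<dots> \<le> measure M {\<omega> \<in> space M. \<bar>U i \<omega>\<bar> > \<epsilon> / 2}
            + measure M {\<omega> \<in> space M. \<bar>V i \<omega>\<bar> > \<epsilon> / 2}"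
          by (intro measure_Un_le) auto
        finally show ?case by simp
      qed
    qed
    then show ?thesis using In_Prob by (simp add: converges_in_prob_def)
  next
    case (In_Lp p)
    with m have p: "p > 0" by simp
    let ?N = "\<lambda>U i. \<integral>\<^sup>+\<omega>. ennreal (\<bar>U i \<omega>\<bar> powr p) \<partial>M"
    have "(?N (\<lambda>i \<omega>. U i \<omega> + V i \<omega>) \<longlongrightarrow> 0) F"
    proof (rule tendsto_sandwich[where f="\<lambda>_. 0"])
      have "((\<lambda>i. ?N U i + ?N V i) \<longlongrightarrow> 0 + 0) F"
        using U V In_Lp by (intro tendsto_add) (auto simp: converges_Lp_def)
      then show "((\<lambda>i. ennreal (2 powr p) * (?N U i + ?N V i)) \<longlongrightarrow> 0) F"
        by (intro tendsto_0_ennreal_cmult) auto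
      show "\<forall>\<^sub>F i in F. ?N (\<lambda>i \<omega>. U i \<omega> + V i \<omega>) i \<le> ennreal (2 powr p) * (?N U i + ?N V i)"
        using U(2) V(2)
      proof eventually_elim
        case (elim i)
        note [measurable] = elim
        have pw: "\<bar>U i \<omega> + V i \<omega>\<bar> powr p \<le> 2 powr p * (\<bar>U i \<omega>\<bar> powr p + \<bar>V i \<omega>\<bar> powr p)" for \<omega>
          by (rule order_trans[OF powr_mono2 powr_add_le]) (use p in auto)
        have "?N (\<lambda>i \<omega>. U i \<omega> + V i \<omega>) i \<le>
          (\<integral>\<^sup>+\<omega>. ennreal (2 powr p) * (ennreal (\<bar>U i \<omega>\<bar> powr p) + ennreal (\<bar>V i \<omega>\<bar> powr p)) \<partial>M)"
          using pw by (intro nn_integral_mono)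
             (simp add: ennreal_mult[symmetric] ennreal_plus[symmetric] ennreal_leI del: ennreal_plus)
        also have "\<dots> = ennreal (2 powr p) * (?N U i + ?N V i)"
          by (subst nn_integral_cmult) (auto simp: nn_integral_add)
        finally show ?case .
      qed
    qed auto
    then show ?thesis using In_Lp by (simp add: converges_Lp_def)
  qed
qed

lemma (in prob_space) vanishes_const:
  assumes m: "valid_mode m" and c: "(c \<longlongrightarrow> 0) F"
  shows "vanishes m M (\<lambda>i \<omega>. c i) F"
proof (cases m)
  case Almost_Surely
  with c show ?thesis by (simp add: converges_AE_def)
next
  case In_Prob
  have "((\<lambda>i. measure M {\<omega> \<in> space M. \<bar>c i\<bar> > \<epsilon>}) \<longlongrightarrow> 0) F" if "\<epsilon> > 0" for \<epsilon>
  proof (rule tendsto_eventually)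
    have "\<forall>\<^sub>F i in F. \<bar>c i\<bar> < \<epsilon>" using c that by (auto simp: tendsto_iff dist_real_def)
    then show "\<forall>\<^sub>F i in F. measure M {\<omega> \<in> space M. \<bar>c i\<bar> > \<epsilon>} = 0"
      by eventually_elim simp
  qed
  with In_Prob show ?thesis by (simp add: converges_in_prob_def)
next
  case (In_Lp p)
  have "((\<lambda>i. \<bar>c i\<bar> powr p) \<longlongrightarrow> 0 powr p) F"
    using In_Lp m c by (intro tendsto_powr' tendsto_rabs_zero) auto
  then have "((\<lambda>i. ennreal (\<bar>c i\<bar> powr p)) \<longlongrightarrow> ennreal 0) F"
    by (intro tendsto_ennrealI) simp
  with In_Lp show ?thesis by (simp add: converges_Lp_def emeasure_space_1)
qed

text \<open>Dominated convergence for the almost sure mode, Markov's inequality for the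
  \<open>p\<close>-th power in the remaining case. The ratio of consecutive normalisers is then
  studied in the weakest mode only.\<close>

lemma (in prob_space) vanishes_imp_in_prob:
  assumes m: "valid_mode m" and Z: "vanishes m M Z sequentially"
    and meas: "\<forall>\<^sub>F n in sequentially. Z n \<in> borel_measurable M"
  shows "vanishes In_Prob M Z sequentially"
proof -
  have "(\<lambda>n. prob {\<omega> \<in> space M. \<bar>Z n \<omega>\<bar> > \<epsilon>}) \<longlonglongrightarrow> 0" if \<epsilon>: "\<epsilon> > 0" for \<epsilon>
  proof (cases m)
    case Almost_Surely
    \<comment> \<open>Measurability holds only eventually, so dominated convergence is applied to
      the sequence shifted by \<open>N\<close>.\<close>
    from meas obtain N where N: "\<And>n. n \<ge> N \<Longrightarrow> Z n \<in> borel_measurable M"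
      by (auto simp: eventually_sequentially)
    let ?I = "\<lambda>n. indicator {\<omega> \<in> space M. \<bar>Z (n + N) \<omega>\<bar> > \<epsilon>} :: 'a \<Rightarrow> real"
    have [measurable]: "Z (n + N) \<in> borel_measurable M" for n by (rule N) simp
    have "(\<lambda>n. integral\<^sup>L M (?I n)) \<longlonglongrightarrow> integral\<^sup>L M (\<lambda>_. 0)"
    proof (rule integral_dominated_convergence[where w="\<lambda>_. 1"])
      have "AE \<omega> in M. (\<lambda>n. Z n \<omega>) \<longlonglongrightarrow> 0"
        using Z Almost_Surely by (simp add: converges_AE_def)
      then show "AE \<omega> in M. (\<lambda>n. ?I n \<omega>) \<longlonglongrightarrow> 0"
      proof eventually_elim
        case (elim \<omega>)
        then have "(\<lambda>n. Z (n + N) \<omega>) \<longlonglongrightarrow> 0" by (rule LIMSEQ_ignore_initial_segment)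
        then have "\<forall>\<^sub>F n in sequentially. \<bar>Z (n + N) \<omega>\<bar> < \<epsilon>"
          using \<epsilon> by (auto simp: tendsto_iff dist_real_def)
        then show ?case by (intro tendsto_eventually) (auto elim!: eventually_mono)
      qed
    qed auto
    then have "(\<lambda>n. prob {\<omega> \<in> space M. \<bar>Z (n + N) \<omega>\<bar> > \<epsilon>}) \<longlonglongrightarrow> 0"
      by (simp add: Int_def conj_commute cong: conj_cong)
    then show ?thesis by (rule LIMSEQ_offset)
  next
    case In_Prob
    with Z \<epsilon> show ?thesis by (simp add: converges_in_prob_def)
  next
    case (In_Lp p)
    with m have p: "p > 0" by simp
    let ?N = "\<lambda>n. \<integral>\<^sup>+\<omega>. ennreal (\<bar>Z n \<omega>\<bar> powr p) \<partial>M"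
    have "(\<lambda>n. emeasure M {\<omega> \<in> space M. \<bar>Z n \<omega>\<bar> > \<epsilon>}) \<longlonglongrightarrow> 0"
    proof (rule tendsto_sandwich[where f="\<lambda>_. 0"])
      show "(\<lambda>n. ennreal (1 / \<epsilon> powr p) * ?N n) \<longlonglongrightarrow> 0"
        using Z In_Lp by (intro tendsto_0_ennreal_cmult) (auto simp: converges_Lp_def)
      show "\<forall>\<^sub>F n in sequentially. emeasure M {\<omega> \<in> space M. \<bar>Z n \<omega>\<bar> > \<epsilon>} \<le> ennreal (1 / \<epsilon> powr p) * ?N n"
        using meas
      proof eventually_elim
        case (elim n)
        note [measurable] = elim
        have "emeasure M {\<omega> \<in> space M. \<bar>Z n \<omega>\<bar> > \<epsilon>}
            = (\<integral>\<^sup>+\<omega>. indicator {\<omega> \<in> space M. \<bar>Z n \<omega>\<bar> > \<epsilon>} \<omega> \<partial>M)" by simp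
        also have "\<dots> \<le> (\<integral>\<^sup>+\<omega>. ennreal (1 / \<epsilon> powr p) * ennreal (\<bar>Z n \<omega>\<bar> powr p) \<partial>M)"
        proof (intro nn_integral_mono)
          fix \<omega>
          have "1 \<le> 1 / \<epsilon> powr p * \<bar>Z n \<omega>\<bar> powr p" if "\<bar>Z n \<omega>\<bar> > \<epsilon>"
            using that \<epsilon> p by (simp add: powr_mono2)
          then show "indicator {\<omega> \<in> space M. \<bar>Z n \<omega>\<bar> > \<epsilon>} \<omega> \<le> ennreal (1 / \<epsilon> powr p) * ennreal (\<bar>Z n \<omega>\<bar> powr p)"
            by (auto simp: indicator_def ennreal_mult[symmetric] simp flip: ennreal_1 intro!: ennreal_leI)
        qed
        also have "\<dots> = ennreal (1 / \<epsilon> powr p) * ?N n" by (rule nn_integral_cmult) measurable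
        finally show ?case .
      qed
    qed auto
    then have "(\<lambda>n. ennreal (prob {\<omega> \<in> space M. \<bar>Z n \<omega>\<bar> > \<epsilon>})) \<longlonglongrightarrow> ennreal 0"
      by (simp add: emeasure_eq_measure)
    then show ?thesis by (subst (asm) tendsto_ennreal_iff) auto
  qed
  then show ?thesis by (simp add: converges_in_prob_def)
qed

text \<open>Every mode depends on the law of \<open>X\<close> alone. This is what later allows a
  weighted sum to be exchanged for its shifted copy.\<close>

lemma vanishes_distr_iff:
  assumes X[measurable]: "X \<in> measurable M N" and h[measurable]: "\<And>n. h n \<in> borel_measurable N"
  shows "vanishes m (distr M N X) h sequentially \<longleftrightarrow> vanishes m M (\<lambda>n \<omega>. h n (X \<omega>)) sequentially"
proof (cases m)
  case Almost_Surely
  \<comment> \<open>Transferring an almost-everywhere statement requires a measurable set. The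
    Cauchy property together with the value of \<open>lim\<close> describes convergence by
    measurable conditions.\<close>
  have "{x \<in> space N. (\<lambda>n. h n x) \<longlonglongrightarrow> 0}
      = {x \<in> space N. Cauchy (\<lambda>n. h n x)} \<inter> {x \<in> space N. lim (\<lambda>n. h n x) = 0}"
    by (auto simp: Cauchy_convergent_iff convergent_LIMSEQ_iff limI convergentI)
  also have "\<dots> \<in> sets N" by (intro sets.Int) measurable
  finally show ?thesis using Almost_Surely by (simp add: converges_AE_def AE_distr_iff)
next
  case In_Prob
  have "measure (distr M N X) {x \<in> space N. \<bar>h n x\<bar> > \<epsilon>} = measure M {\<omega> \<in> space M. \<bar>h n (X \<omega>)\<bar> > \<epsilon>}" for n \<epsilon>
    using measurable_space[OF X] by (subst measure_distr) (auto intro!: arg_cong[where f="measure M"])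
  with In_Prob show ?thesis by (simp add: converges_in_prob_def)
next
  case (In_Lp p)
  then show ?thesis by (simp add: converges_Lp_def nn_integral_distr)
qed

section \<open>One-sided convergence of quotients\<close>

text \<open>For \<tau> = 1 and \<tau> = -1 these are the positive and the negative part of
  \<open>Y / b - 1\<close>. A sign as parameter lets increasing and decreasing integrands share all
  statements.\<close>

definition excess :: "real \<Rightarrow> ('i \<Rightarrow> 'a \<Rightarrow> real) \<Rightarrow> ('i \<Rightarrow> real) \<Rightarrow> 'i \<Rightarrow> 'a \<Rightarrow> real" where
  "excess \<tau> Y b i \<omega> = max 0 (\<tau> * (Y i \<omega> / b i - 1))"

lemma measurable_excess [measurable]:
  "Y i \<in> borel_measurable M \<Longrightarrow> excess \<tau> Y b i \<in> borel_measurable M"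
  by (simp add: excess_def[abs_def])

lemma vanishes_excess_compose:
  assumes "vanishes m M (excess \<tau> Y b) F" "filterlim h F G"
  shows "vanishes m M (excess \<tau> (\<lambda>i. Y (h i)) (\<lambda>i. b (h i))) G"
  using converges_compose[OF assms] by (simp add: excess_def[abs_def])

text \<open>Both parts are dominated by the deviation, and their sum is its absolute value.\<close>

lemma converges_iff_excess:
  assumes m: "valid_mode m" and M: "finite_measure M" and \<sigma>: "\<bar>\<sigma>\<bar> = 1"
    and meas: "\<forall>\<^sub>F i in F. Y i \<in> borel_measurable M"
  shows "converges m M (\<lambda>i \<omega>. Y i \<omega> / b i) 1 F \<longleftrightarrow>
    vanishes m M (excess \<sigma> Y b) F \<and> vanishes m M (excess (- \<sigma>) Y b) F"
proof
  assume "converges m M (\<lambda>i \<omega>. Y i \<omega> / b i) 1 F"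
  then have *: "vanishes m M (\<lambda>i \<omega>. Y i \<omega> / b i - 1) F"
    by (simp add: converges_iff_vanishes[where c=1])
  have "vanishes m M (excess \<tau> Y b) F" if "\<bar>\<tau>\<bar> = 1" for \<tau>
  proof (rule vanishes_dominated[OF m M *, where C=1])
    show "\<forall>\<^sub>F i in F. (\<lambda>\<omega>. Y i \<omega> / b i - 1) \<in> borel_measurable M"
      using meas by eventually_elim simp
    have "\<bar>\<tau> * x\<bar> = \<bar>x\<bar>" for x using that by (simp add: abs_mult)
    then show "\<forall>\<^sub>F i in F. \<forall>\<omega>\<in>space M. \<bar>excess \<tau> Y b i \<omega>\<bar> \<le> 1 * \<bar>Y i \<omega> / b i - 1\<bar>"
      by (intro always_eventually allI ballI) (simp add: excess_def, metis abs_ge_self)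
  qed
  with \<sigma> show "vanishes m M (excess \<sigma> Y b) F \<and> vanishes m M (excess (- \<sigma>) Y b) F" by simp
next
  assume "vanishes m M (excess \<sigma> Y b) F \<and> vanishes m M (excess (- \<sigma>) Y b) F"
  moreover have "\<forall>\<^sub>F i in F. excess \<tau> Y b i \<in> borel_measurable M" for \<tau>
    using meas by eventually_elim (rule measurable_excess)
  ultimately have *: "vanishes m M (\<lambda>i \<omega>. excess \<sigma> Y b i \<omega> + excess (- \<sigma>) Y b i \<omega>) F"
    by (intro vanishes_add m M) auto
  have "vanishes m M (\<lambda>i \<omega>. Y i \<omega> / b i - 1) F"
  proof (rule vanishes_dominated[OF m M *, where C=1])
    show "\<forall>\<^sub>F i in F. (\<lambda>\<omega>. excess \<sigma> Y b i \<omega> + excess (- \<sigma>) Y b i \<omega>) \<in> borel_measurable M"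
      using meas by eventually_elim (intro borel_measurable_add measurable_excess)
    have "\<bar>Y i \<omega> / b i - 1\<bar> \<le> \<bar>excess \<sigma> Y b i \<omega> + excess (- \<sigma>) Y b i \<omega>\<bar>" for i \<omega>
      using \<sigma> by (auto simp: excess_def max_def abs_if split: if_splits)
    then show "\<forall>\<^sub>F i in F. \<forall>\<omega>\<in>space M. \<bar>Y i \<omega> / b i - 1\<bar>
        \<le> 1 * \<bar>excess \<sigma> Y b i \<omega> + excess (- \<sigma>) Y b i \<omega>\<bar>" by simp
  qed
  then show "converges m M (\<lambda>i \<omega>. Y i \<omega> / b i) 1 F"
    by (simp add: converges_iff_vanishes[where c=1])
qed

text \<open>With \<open>r = b i / b' i\<close>, the inequality \<open>le\<close> yields
  \<open>\<tau> * (Y' / b' - 1) \<le> r * (\<tau> * (Y / b - 1)) + \<tau> * (r - 1) + U /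
  b'\<close>. Eventually \<open>r < 2\<close>, which explains the factor \<open>2\<close> in the
  domination by \<open>?V\<close>.\<close>

lemma (in prob_space) vanishes_excess_transfer:
  assumes m: "valid_mode m" and \<tau>: "\<bar>\<tau>\<bar> = 1"
    and Y: "vanishes m M (excess \<tau> Y b) F" "\<forall>\<^sub>F i in F. Y i \<in> borel_measurable M"
    and U: "vanishes m M (\<lambda>i \<omega>. U \<omega> / b' i) F" "U \<in> borel_measurable M" "\<And>\<omega>. \<omega> \<in> space M \<Longrightarrow> 0 \<le> U \<omega>"
    and le: "\<forall>\<^sub>F i in F. \<forall>\<omega>\<in>space M. \<tau> * Y' i \<omega> \<le> \<tau> * Y i \<omega> + U \<omega>"
    and ratio: "((\<lambda>i. b i / b' i) \<longlongrightarrow> 1) F"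
    and pos: "\<forall>\<^sub>F i in F. 0 < b i" "\<forall>\<^sub>F i in F. 0 < b' i"
  shows "vanishes m M (excess \<tau> Y' b') F"
proof -
  let ?V = "\<lambda>i \<omega>. excess \<tau> Y b i \<omega> + (\<bar>b i / b' i - 1\<bar> + U \<omega> / b' i)"
  have M: "finite_measure M" by unfold_locales
  have measV: "\<forall>\<^sub>F i in F. excess \<tau> Y b i \<in> borel_measurable M"
    using Y(2) by eventually_elim (rule measurable_excess)
  have "((\<lambda>i. \<bar>b i / b' i - 1\<bar>) \<longlongrightarrow> 0) F"
    using ratio by (intro tendsto_rabs_zero) (simp add: LIM_zero_iff)
  then have "vanishes m M (\<lambda>i \<omega>. \<bar>b i / b' i - 1\<bar>) F" by (rule vanishes_const[OF m])
  then have V: "vanishes m M ?V F"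
    using U Y measV by (intro vanishes_add[OF m M]) auto
  have b2: "\<forall>\<^sub>F i in F. b i / b' i < 2" using ratio by (rule order_tendstoD) simp
  show ?thesis
  proof (rule vanishes_dominated[OF m M V, where C=2])
    show "\<forall>\<^sub>F i in F. ?V i \<in> borel_measurable M"
      using measV by eventually_elim (intro borel_measurable_add borel_measurable_divide borel_measurable_const U)
    show "\<forall>\<^sub>F i in F. \<forall>\<omega>\<in>space M. \<bar>excess \<tau> Y' b' i \<omega>\<bar> \<le> 2 * \<bar>?V i \<omega>\<bar>"
      using le pos b2
    proof (eventually_elim, intro ballI)
      fix i \<omega> assume *: "\<forall>\<omega>\<in>space M. \<tau> * Y' i \<omega> \<le> \<tau> * Y i \<omega> + U \<omega>"
        "0 < b i" "0 < b' i" "b i / b' i < 2" and \<omega>: "\<omega> \<in> space M"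
      let ?e = "excess \<tau> Y b i \<omega>" and ?r = "b i / b' i"
      have e: "0 \<le> ?e" "\<tau> * (Y i \<omega> / b i - 1) \<le> ?e" by (simp_all add: excess_def)
      have r: "0 < ?r" using * by simp
      have u: "0 \<le> U \<omega> / b' i" using U(3)[OF \<omega>] * by simp
      have "\<tau> * (Y' i \<omega> / b' i - 1) = (\<tau> * Y' i \<omega>) / b' i - \<tau>" by (simp add: algebra_simps)
      also have "\<dots> \<le> (\<tau> * Y i \<omega> + U \<omega>) / b' i - \<tau>"
        using * \<omega> by (intro diff_right_mono divide_right_mono) auto
      also have "\<dots> = ?r * (\<tau> * (Y i \<omega> / b i - 1)) + \<tau> * (?r - 1) + U \<omega> / b' i"
        using * by (simp add: field_simps)
      also have "\<dots> \<le> 2 * ?e + \<bar>?r - 1\<bar> + U \<omega> / b' i"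
      proof -
        have "?r * (\<tau> * (Y i \<omega> / b i - 1)) \<le> ?r * ?e" using e r by (intro mult_left_mono) auto
        also have "\<dots> \<le> 2 * ?e" using e *(4) by (intro mult_right_mono) auto
        moreover have "\<tau> * (?r - 1) \<le> \<bar>?r - 1\<bar>" using \<tau> by (metis abs_ge_self abs_mult mult_1)
        ultimately show ?thesis by linarith
      qed
      also have "\<dots> \<le> 2 * ?V i \<omega>"
      proof -
        have "2 * x + y + z \<le> 2 * (x + (y + z))" if "0 \<le> y" "0 \<le> z" for x y z :: real
          using that by simp
        from this[OF abs_ge_zero u] show ?thesis .
      qed
      finally have "\<tau> * (Y' i \<omega> / b' i - 1) \<le> 2 * ?V i \<omega>" .
      then show "\<bar>excess \<tau> Y' b' i \<omega>\<bar> \<le> 2 * \<bar>?V i \<omega>\<bar>"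
        using e u by (simp add: excess_def[of \<tau> Y'])
    qed
  qed
qed

text \<open>In the \<open>L\<^sup>p\<close> modes the moments of \<open>U\<close> are inherited from those of \<open>Y n\<close>.\<close>

lemma (in prob_space) vanishes_over_normaliser:
  assumes m: "valid_mode m" and Y: "converges m M (\<lambda>n \<omega>. Y n \<omega> / b n) 1 sequentially"
    and meas: "\<And>n. Y n \<in> borel_measurable M" "U \<in> borel_measurable M"
    and b: "filterlim b at_top sequentially"
    and U: "\<And>\<omega>. \<omega> \<in> space M \<Longrightarrow> 0 \<le> U \<omega>"
           "\<And>n \<omega>. \<omega> \<in> space M \<Longrightarrow> n \<ge> 1 \<Longrightarrow> U \<omega> \<le> K * Y n \<omega>"
    and b': "filterlim b' at_top F"
  shows "vanishes m M (\<lambda>i \<omega>. U \<omega> / b' i) F"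
proof (cases m)
  case Almost_Surely
  have "((\<lambda>i. U \<omega> / b' i) \<longlongrightarrow> 0) F" for \<omega>
    using b' by (intro real_tendsto_divide_at_top) auto
  then show ?thesis using Almost_Surely by (simp add: converges_AE_def)
next
  case In_Prob
  note [measurable] = meas
  have "((\<lambda>i. prob {\<omega> \<in> space M. \<bar>U \<omega> / b' i\<bar> > \<epsilon>}) \<longlongrightarrow> 0) F" if \<epsilon>: "\<epsilon> > 0" for \<epsilon>
  proof -
    \<comment> \<open>The exceedance probability of \<open>U / b' i\<close> is at most the tail of
      the law of \<open>U\<close> beyond \<open>\<epsilon> * b' i\<close>.\<close>
    interpret D: real_distribution "distr M borel U"
      by (rule real_distribution_distr[OF meas(2)])
    have "((\<lambda>x. 1 - cdf (distr M borel U) x) \<longlongrightarrow> 1 - 1) at_top"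
      by (intro tendsto_intros D.cdf_lim_at_top_prob)
    then have lim: "((\<lambda>i. 1 - cdf (distr M borel U) (\<epsilon> * b' i)) \<longlongrightarrow> 0) F"
      using filterlim_compose[OF _ filterlim_tendsto_pos_mult_at_top[OF tendsto_const \<epsilon> b']] by force
    show ?thesis
    proof (rule Lim_null_comparison[OF _ lim])
      have "\<forall>\<^sub>F i in F. b' i > 0" using b' by (simp add: filterlim_at_top_dense)
      then show "\<forall>\<^sub>F i in F. norm (prob {\<omega> \<in> space M. \<bar>U \<omega> / b' i\<bar> > \<epsilon>})
          \<le> 1 - cdf (distr M borel U) (\<epsilon> * b' i)"
      proof eventually_elim
        case (elim i)
        have "1 - cdf (distr M borel U) (\<epsilon> * b' i) = prob (space M - (U -` {..\<epsilon> * b' i} \<inter> space M))"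
          by (subst prob_compl) (auto simp: cdf_def measure_distr)
        moreover have "{\<omega> \<in> space M. \<bar>U \<omega> / b' i\<bar> > \<epsilon>} \<subseteq> space M - (U -` {..\<epsilon> * b' i} \<inter> space M)"
          using elim U(1) by (auto simp: field_simps)
        ultimately show ?case by (simp add: finite_measure_mono)
      qed
    qed
  qed
  then show ?thesis using In_Prob by (simp add: converges_in_prob_def)
next
  case (In_Lp p)
  with m have p: "p > 0" by simp
  note [measurable] = meas
  let ?I = "\<lambda>Y. \<integral>\<^sup>+\<omega>. ennreal (\<bar>Y \<omega>\<bar> powr p) \<partial>M"
  have "(\<lambda>n. ?I (\<lambda>\<omega>. Y n \<omega> / b n - 1)) \<longlonglongrightarrow> 0"
    using Y In_Lp by (simp add: converges_Lp_def)
  then have "\<forall>\<^sub>F n in sequentially. ?I (\<lambda>\<omega>. Y n \<omega> / b n - 1) < 1"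
    by (rule order_tendstoD) simp
  moreover have "\<forall>\<^sub>F n in sequentially. b n > 0" using b by (simp add: filterlim_at_top_dense)
  ultimately have "\<forall>\<^sub>F n in sequentially. ?I (\<lambda>\<omega>. Y n \<omega> / b n - 1) < 1 \<and> b n > 0 \<and> n \<ge> 1"
    using eventually_ge_at_top[of "1::nat"] by eventually_elim simp
  \<comment> \<open>One such index is enough: the \<open>p\<close>-th moment of the deviation of
    \<open>Y n / b n\<close> is finite, and \<open>U \<le> K * Y n\<close> passes this on to
    \<open>U\<close>.\<close>
  then obtain n where n: "?I (\<lambda>\<omega>. Y n \<omega> / b n - 1) < 1" "b n > 0" "n \<ge> 1"
    by (auto simp: eventually_sequentially)
  let ?C = "(\<bar>K\<bar> * b n) powr p * 2 powr p"
  have "?I U \<le> (\<integral>\<^sup>+\<omega>. ennreal ?C * (ennreal (\<bar>Y n \<omega> / b n - 1\<bar> powr p) + 1) \<partial>M)"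
  proof (intro nn_integral_mono)
    fix \<omega> assume \<omega>: "\<omega> \<in> space M"
    have "\<bar>U \<omega>\<bar> \<le> \<bar>K * Y n \<omega>\<bar>" using U(1)[OF \<omega>] U(2)[OF \<omega> n(3)] by linarith
    also have "\<dots> = \<bar>K\<bar> * \<bar>Y n \<omega>\<bar>" by (rule abs_mult)
    finally have UY: "\<bar>U \<omega>\<bar> \<le> \<bar>K\<bar> * \<bar>Y n \<omega>\<bar>" .
    have "\<bar>Y n \<omega>\<bar> = b n * \<bar>(Y n \<omega> / b n - 1) + 1\<bar>" using n(2) by simp
    also have "\<dots> \<le> b n * (\<bar>Y n \<omega> / b n - 1\<bar> + 1)"
      using n(2) by (intro mult_left_mono order_trans[OF abs_triangle_ineq]) auto
    finally have "\<bar>K\<bar> * \<bar>Y n \<omega>\<bar> \<le> \<bar>K\<bar> * (b n * (\<bar>Y n \<omega> / b n - 1\<bar> + 1))"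
      by (rule mult_left_mono) simp
    with UY have "\<bar>U \<omega>\<bar> \<le> (\<bar>K\<bar> * b n) * (\<bar>Y n \<omega> / b n - 1\<bar> + 1)"
      unfolding mult.assoc by (rule order_trans)
    then have "\<bar>U \<omega>\<bar> powr p \<le> ((\<bar>K\<bar> * b n) * (\<bar>Y n \<omega> / b n - 1\<bar> + 1)) powr p"
      using p by (intro powr_mono2) auto
    also have "\<dots> = (\<bar>K\<bar> * b n) powr p * (\<bar>Y n \<omega> / b n - 1\<bar> + 1) powr p"
      using n by (subst powr_mult) auto
    also have "\<dots> \<le> (\<bar>K\<bar> * b n) powr p * (2 powr p * (\<bar>Y n \<omega> / b n - 1\<bar> powr p + 1 powr p))"
      using p by (intro mult_left_mono powr_add_le) auto
    finally have "\<bar>U \<omega>\<bar> powr p \<le> ?C * (\<bar>Y n \<omega> / b n - 1\<bar> powr p + 1)" by (simp add: mult_ac)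
    then show "ennreal (\<bar>U \<omega>\<bar> powr p) \<le> ennreal ?C * (ennreal (\<bar>Y n \<omega> / b n - 1\<bar> powr p) + 1)"
      by (simp add: ennreal_mult[symmetric] ennreal_leI flip: ennreal_1 ennreal_plus)
  qed
  also have "\<dots> = ennreal ?C * (?I (\<lambda>\<omega>. Y n \<omega> / b n - 1) + 1)"
    by (subst nn_integral_cmult) (auto simp: nn_integral_add emeasure_space_1)
  also have "\<dots> < \<infinity>"
    using order.strict_trans[OF n(1) ennreal_one_less_top] by (simp add: ennreal_mult_less_top)
  finally have fin: "?I U < \<infinity>" .
  then obtain c where c: "?I U = ennreal c" "0 \<le> c" by (cases "?I U") auto
  have "((\<lambda>i. ?I (\<lambda>\<omega>. U \<omega> / b' i)) \<longlongrightarrow> 0) F"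
  proof (rule Lim_transform_eventually)
    have "((\<lambda>i. c * b' i powr (- p)) \<longlongrightarrow> 0) F"
      by (rule tendsto_mult_right_zero[OF tendsto_neg_powr[OF _ b']]) (simp add: p)
    then have "((\<lambda>i. ennreal (c * b' i powr (- p))) \<longlongrightarrow> ennreal 0) F" by (rule tendsto_ennrealI)
    then show "((\<lambda>i. ennreal (c * b' i powr (- p))) \<longlongrightarrow> 0) F" by simp
    have "\<forall>\<^sub>F i in F. b' i > 0" using b' by (simp add: filterlim_at_top_dense)
    then show "\<forall>\<^sub>F i in F. ennreal (c * b' i powr (- p)) = ?I (\<lambda>\<omega>. U \<omega> / b' i)"
    proof eventually_elim
      case (elim i)
      have "\<bar>U \<omega> / b' i\<bar> powr p = b' i powr (- p) * \<bar>U \<omega>\<bar> powr p" for \<omega>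
        using elim by (simp add: abs_divide powr_divide powr_minus_divide)
      then have "?I (\<lambda>\<omega>. U \<omega> / b' i) = (\<integral>\<^sup>+\<omega>. ennreal (b' i powr (- p)) * ennreal (\<bar>U \<omega>\<bar> powr p) \<partial>M)"
        by (simp only: ennreal_mult powr_ge_zero)
      also have "\<dots> = ennreal (b' i powr (- p)) * ennreal c" using c by (subst nn_integral_cmult) auto
      finally show ?case using c by (simp add: ennreal_mult mult.commute)
    qed
  qed
  then show ?thesis using In_Lp by (simp add: converges_Lp_def)
qed

text \<open>
  With \<open>\<xi> = (Y (Suc n) - Y n) / (b (Suc n) - b n)\<close> and \<open>r = 1 - b n / b (Suc n)\<close>, convergence of
  \<open>Y n / b n\<close> makes \<open>r * (\<xi> - 1)\<close> tend to \<open>0\<close> in probability. Since \<open>exp (- 1) < 1 / 2\<close>, the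
  assumption on the Laplace transform keeps \<open>\<xi>\<close> away from \<open>1\<close>, hence \<open>r\<close> tends to \<open>0\<close>.
\<close>

lemma (in prob_space) normaliser_ratio_tendsto_1:
  assumes m: "valid_mode m" and Y: "converges m M (\<lambda>n \<omega>. Y n \<omega> / b n) 1 sequentially"
    and meas: "\<And>n. Y n \<in> borel_measurable M"
    and b: "filterlim b at_top sequentially" "\<And>n. b n \<le> b (Suc n)"
    and Y_mono: "\<And>n \<omega>. \<omega> \<in> space M \<Longrightarrow> Y n \<omega> \<le> Y (Suc n) \<omega>"
    and laplace: "\<And>n. b n < b (Suc n) \<Longrightarrow>
      1 / 2 \<le> expectation (\<lambda>\<omega>. exp (- ((Y (Suc n) \<omega> - Y n \<omega>) / (b (Suc n) - b n))))"
  shows "(\<lambda>n. b n / b (Suc n)) \<longlonglongrightarrow> 1"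
proof -
  note [measurable] = meas
  define r where "r n = 1 - b n / b (Suc n)" for n
  define V where "V n \<omega> = (Y (Suc n) \<omega> - Y n \<omega>) / b (Suc n) - r n" for n \<omega>
  have [measurable]: "V n \<in> borel_measurable M" for n by (simp add: V_def[abs_def])
  have M: "finite_measure M" by unfold_locales
  have pos: "\<forall>\<^sub>F n in sequentially. b n > 0" using b by (simp add: filterlim_at_top_dense)
  have Y0: "vanishes m M (\<lambda>n \<omega>. Y n \<omega> / b n - 1) sequentially"
    using Y by (simp add: converges_iff_vanishes[where c=1])
  have Y1: "vanishes m M (\<lambda>n \<omega>. Y (Suc n) \<omega> / b (Suc n) - 1) sequentially"
    using Y0 by (rule converges_compose) (rule filterlim_Suc)
  have "vanishes m M (\<lambda>n \<omega>. \<bar>Y n \<omega> / b n - 1\<bar>) sequentially"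
    "vanishes m M (\<lambda>n \<omega>. \<bar>Y (Suc n) \<omega> / b (Suc n) - 1\<bar>) sequentially"
    by (rule vanishes_dominated[OF m M Y0, where C=1] vanishes_dominated[OF m M Y1, where C=1]; simp)+
  then have sum: "vanishes m M (\<lambda>n \<omega>. \<bar>Y n \<omega> / b n - 1\<bar> + \<bar>Y (Suc n) \<omega> / b (Suc n) - 1\<bar>) sequentially"
    by (intro vanishes_add m M) simp_all
  have "vanishes m M V sequentially"
  proof (rule vanishes_dominated[OF m M sum, where C=1])
    show "\<forall>\<^sub>F n in sequentially. \<forall>\<omega>\<in>space M. \<bar>V n \<omega>\<bar>
        \<le> 1 * \<bar>\<bar>Y n \<omega> / b n - 1\<bar> + \<bar>Y (Suc n) \<omega> / b (Suc n) - 1\<bar>\<bar>"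
      using pos
    proof (eventually_elim, intro ballI)
      fix n \<omega> assume bn: "0 < b n"
      let ?q = "b n / b (Suc n)"
      have q: "0 \<le> ?q" "?q \<le> 1" using bn b(2)[of n] by (auto simp: field_simps)
      \<comment> \<open>\<open>V n\<close> is the new deviation minus \<open>?q\<close> times the
        old one. As \<open>?q\<close> lies between \<open>0\<close> and \<open>1\<close>, the sum of
        the absolute deviations dominates it.\<close>
      have "V n \<omega> = (Y (Suc n) \<omega> / b (Suc n) - 1) - ?q * (Y n \<omega> / b n - 1)"
        using bn b(2)[of n] by (simp add: V_def r_def field_simps)
      moreover have "\<bar>?q * (Y n \<omega> / b n - 1)\<bar> \<le> 1 * \<bar>Y n \<omega> / b n - 1\<bar>"
        using q unfolding abs_mult by (intro mult_right_mono) auto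
      moreover have "\<bar>x - y\<bar> \<le> 1 * \<bar>\<bar>z\<bar> + \<bar>x\<bar>\<bar>" if "\<bar>y\<bar> \<le> 1 * \<bar>z\<bar>" for x y z :: real
        using that by (simp add: abs_if split: if_splits)
      ultimately show "\<bar>V n \<omega>\<bar> \<le> 1 * \<bar>\<bar>Y n \<omega> / b n - 1\<bar> + \<bar>Y (Suc n) \<omega> / b (Suc n) - 1\<bar>\<bar>"
        by simp
    qed
  qed simp
  then have V: "vanishes In_Prob M V sequentially"
    by (rule vanishes_imp_in_prob[OF m]) simp
  have "r \<longlonglongrightarrow> 0"
  proof (rule tendstoI)
    fix \<delta> :: real assume \<delta>: "\<delta> > 0"
    \<comment> \<open>If \<open>r n \<ge> \<delta>\<close> and \<open>\<xi> \<omega> < 9/10\<close>,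
      then \<open>\<bar>V n \<omega>\<bar>\<close> exceeds \<open>\<delta> / 20\<close>. Outside
      this event \<open>exp (- \<xi> \<omega>)\<close> is at most \<open>435/1000\<close>, and
      adding \<open>1/20\<close> for the event still gives less than \<open>1/2\<close>, against the
      Laplace bound.\<close>
    have "(\<lambda>n. prob {\<omega> \<in> space M. \<bar>V n \<omega>\<bar> > \<delta> / 20}) \<longlonglongrightarrow> 0"
      using V \<delta> by (auto simp: converges_in_prob_def dest: spec[of _ "\<delta> / 20"])
    then have "\<forall>\<^sub>F n in sequentially. prob {\<omega> \<in> space M. \<bar>V n \<omega>\<bar> > \<delta> / 20} < 1 / 20"
      by (rule order_tendstoD) simp
    then show "\<forall>\<^sub>F n in sequentially. dist (r n) 0 < \<delta>"
      using pos
    proof eventually_elim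
      case (elim n)
      have b1: "b (Suc n) > 0" using elim b(2)[of n] by simp
      have r0: "r n \<ge> 0" using b(2)[of n] b1 by (simp add: r_def field_simps)
      have "r n < \<delta>"
      proof (rule ccontr)
        assume "\<not> r n < \<delta>"
        then have r\<delta>: "\<delta> \<le> r n" by simp
        then have "r n > 0" using \<delta> by simp
        then have less: "b n < b (Suc n)" using b1 by (simp add: r_def)
        define \<xi> where "\<xi> \<omega> = (Y (Suc n) \<omega> - Y n \<omega>) / (b (Suc n) - b n)" for \<omega>
        have [measurable]: "\<xi> \<in> borel_measurable M" by (simp add: \<xi>_def[abs_def])
        have \<xi>0: "\<xi> \<omega> \<ge> 0" if "\<omega> \<in> space M" for \<omega>
          using Y_mono[OF that, of n] less by (simp add: \<xi>_def)
        have V_eq: "V n \<omega> = r n * (\<xi> \<omega> - 1)" for \<omega>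
        proof -
          have "r n * \<xi> \<omega> = (Y (Suc n) \<omega> - Y n \<omega>) / b (Suc n)"
            using less b1 by (simp add: r_def \<xi>_def field_simps)
          then show ?thesis by (simp add: V_def algebra_simps)
        qed
        let ?E = "{\<omega> \<in> space M. \<bar>V n \<omega>\<bar> > \<delta> / 20}"
        have e: "exp (- (9/10)) \<le> (435/1000 :: real)"
        proof -
          \<comment> \<open>The quadratic Taylor polynomial at \<open>9/10\<close> has the value
            \<open>2305/1000\<close>.\<close>
          have "1000/435 \<le> exp (9/10 :: real)"
            using exp_lower_Taylor_quadratic[of "9/10 :: real"] by (simp add: power2_eq_square)
          then show ?thesis by (simp add: exp_minus field_simps)
        qed
        have "1 / 2 \<le> expectation (\<lambda>\<omega>. exp (- \<xi> \<omega>))"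
          using laplace[OF less] by (simp add: \<xi>_def)
        also have "\<dots> \<le> expectation (\<lambda>\<omega>. 435/1000 + indicator ?E \<omega>)"
        proof (rule integral_mono)
          show "integrable M (\<lambda>\<omega>. exp (- \<xi> \<omega>))"
            by (rule integrable_const_bound[where B=1]) (auto intro!: AE_I2 \<xi>0)
          show "integrable M (\<lambda>\<omega>. 435/1000 + indicator ?E \<omega> :: real)"
            by (intro Bochner_Integration.integrable_add integrable_const integrable_real_indicator)
               (auto simp: emeasure_eq_measure)
          fix \<omega> assume \<omega>: "\<omega> \<in> space M"
          show "exp (- \<xi> \<omega>) \<le> 435/1000 + indicator ?E \<omega>"
          proof (cases "\<xi> \<omega> < 9/10")
            case True
            have "\<delta> / 10 \<le> r n * (1 - \<xi> \<omega>)"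
              using mult_mono[OF r\<delta>, of "1/10" "1 - \<xi> \<omega>"] True r0 by simp
            then have "\<omega> \<in> ?E" using \<omega> \<delta> True r0
              by (auto simp: V_eq abs_mult)
            then have "indicator ?E \<omega> = (1 :: real)" by (rule indicator_simps)
            moreover have "exp (- \<xi> \<omega>) \<le> 1" using \<xi>0[OF \<omega>] by simp
            ultimately show ?thesis by linarith
          next
            case False
            then have "exp (- \<xi> \<omega>) \<le> exp (- (9/10))" by simp
            moreover have "(0::real) \<le> indicator ?E \<omega>" by simp
            ultimately show ?thesis using e by linarith
          qed
        qed
        also have "\<dots> = 435/1000 + prob ?E"
          by (subst Bochner_Integration.integral_add) (auto simp: emeasure_eq_measure prob_space)
        finally show False using elim(1) by simp
      qed
      with r0 show ?case by simp
    qed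
  qed
  then have "(\<lambda>n. 1 - r n) \<longlonglongrightarrow> 1 - 0" by (intro tendsto_intros)
  then show ?thesis by (simp add: r_def)
qed

section \<open>Asymptotic equivalence of normalisers\<close>

lemma ratio_tendsto_1_if_bounded_difference:
  fixes a b :: "'i \<Rightarrow> real"
  assumes "filterlim b at_top F" "\<forall>\<^sub>F i in F. \<bar>a i - b i\<bar> \<le> c"
  shows "((\<lambda>i. a i / b i) \<longlongrightarrow> 1) F"
proof (rule LIM_zero_cancel, rule Lim_null_comparison)
  show "((\<lambda>i. c / b i) \<longlongrightarrow> 0) F" using assms(1) by (intro real_tendsto_divide_at_top) auto
  have "\<forall>\<^sub>F i in F. b i > 0" using assms(1) by (simp add: filterlim_at_top_dense)
  then show "\<forall>\<^sub>F i in F. norm (a i / b i - 1) \<le> c / b i"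
    using assms(2)
  proof eventually_elim
    case (elim i)
    then have "a i / b i - 1 = (a i - b i) / b i" by (simp add: field_simps)
    with elim show ?case by (simp add: divide_right_mono)
  qed
qed

lemma ratio_inverse_tendsto_1:
  fixes a b :: "'i \<Rightarrow> real"
  assumes "((\<lambda>i. a i / b i) \<longlongrightarrow> 1) F"
  shows "((\<lambda>i. b i / a i) \<longlongrightarrow> 1) F"
  using tendsto_inverse[OF assms] by simp

lemma ratio_trans_tendsto_1:
  fixes a b c :: "'i \<Rightarrow> real"
  assumes "((\<lambda>i. a i / b i) \<longlongrightarrow> 1) F" "((\<lambda>i. b i / c i) \<longlongrightarrow> 1) F" "\<forall>\<^sub>F i in F. b i > 0"
  shows "((\<lambda>i. a i / c i) \<longlongrightarrow> 1) F"
proof (rule Lim_transform_eventually)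
  show "((\<lambda>i. a i / b i * (b i / c i)) \<longlongrightarrow> 1) F" using tendsto_mult[OF assms(1,2)] by simp
  show "\<forall>\<^sub>F i in F. a i / b i * (b i / c i) = a i / c i"
    using assms(3) by eventually_elim simp
qed

text \<open>\<open>\<sigma>\<close> is \<open>1\<close> when the integrand increases and \<open>- 1\<close> when it decreases.\<close>

lemma normalisers_equivalent:
  fixes lam :: "real \<Rightarrow> real" and W :: "nat \<Rightarrow> real"
  assumes \<sigma>: "\<bar>\<sigma>\<bar> = 1"
    and lam_mono: "\<And>s t. 0 \<le> s \<Longrightarrow> s \<le> t \<Longrightarrow> lam s \<le> lam t"
    and lam_top: "filterlim lam at_top at_top"
    and W_mono: "\<And>n. W n \<le> W (Suc n)"
    and W: "\<And>n. \<sigma> * lam (real n) \<le> \<sigma> * W n" "\<And>n. \<sigma> * W n \<le> \<sigma> * lam (real (Suc n)) + \<kappa>" "0 \<le> \<kappa>"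
    and ratio: "(\<lambda>n. lam (real n) / lam (real (Suc n))) \<longlonglongrightarrow> 1 \<or> (\<lambda>n. W n / W (Suc n)) \<longlonglongrightarrow> 1"
  shows "(\<lambda>n. lam (real n) / lam (real (Suc n))) \<longlonglongrightarrow> 1" "(\<lambda>n. W n / lam (real n)) \<longlonglongrightarrow> 1"
proof -
  have lam_n: "filterlim (\<lambda>n. lam (real n)) at_top sequentially"
    by (rule filterlim_compose[OF lam_top filterlim_real_sequentially])
  have W_n: "filterlim W at_top sequentially"
  proof (rule filterlim_at_top_mono)
    show "filterlim (\<lambda>n. - \<kappa> + lam (real n)) at_top sequentially"
      by (rule filterlim_tendsto_add_at_top[OF tendsto_const lam_n])
    \<comment> \<open>For \<sigma> = 1 this comes from \<open>W(1)\<close> and the sign of \<kappa>,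
      for \<sigma> = -1 from \<open>W(2)\<close> and the monotonicity of \<open>lam\<close>.\<close>
    have "lam (real n) - \<kappa> \<le> W n" for n
      using W(1,2)[of n] W(3) lam_mono[of "real n" "real (Suc n)"] \<sigma> by (auto simp: abs_if split: if_splits)
    then show "\<forall>\<^sub>F n in sequentially. - \<kappa> + lam (real n) \<le> W n" by (simp add: algebra_simps)
  qed
  have pos: "\<forall>\<^sub>F n in sequentially. lam (real n) > 0" "\<forall>\<^sub>F n in sequentially. W n > 0"
    using lam_n W_n by (simp_all add: filterlim_at_top_dense)
  have ratio_sub: "(\<lambda>n. (b (Suc n) - b n) / b n) \<longlonglongrightarrow> 0"
    if "(\<lambda>n. b n / b (Suc n)) \<longlonglongrightarrow> 1" "\<forall>\<^sub>F n in sequentially. b n > 0" for b :: "nat \<Rightarrow> real"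
  proof (rule Lim_transform_eventually)
    show "(\<lambda>n. b (Suc n) / b n - 1) \<longlonglongrightarrow> 0"
      using ratio_inverse_tendsto_1[OF that(1)] by (simp add: LIM_zero_iff)
    show "\<forall>\<^sub>F n in sequentially. b (Suc n) / b n - 1 = (b (Suc n) - b n) / b n"
      using that(2) by eventually_elim (simp add: field_simps)
  qed
  \<comment> \<open>An error of at most the next increment of \<open>b\<close> plus a constant is
    negligible against \<open>b\<close>, since consecutive values of \<open>b\<close> are equivalent
    and \<open>b\<close> diverges.\<close>
  have near: "(\<lambda>n. a n / b n) \<longlonglongrightarrow> 1"
    if "(\<lambda>n. b n / b (Suc n)) \<longlonglongrightarrow> 1" "filterlim b at_top sequentially"
      "\<And>n. \<bar>a n - b n\<bar> \<le> (b (Suc n) - b n) + \<kappa>" for a b :: "nat \<Rightarrow> real"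
  proof (rule LIM_zero_cancel, rule Lim_null_comparison)
    have pos: "\<forall>\<^sub>F n in sequentially. b n > 0" using that(2) by (simp add: filterlim_at_top_dense)
    show "(\<lambda>n. (b (Suc n) - b n) / b n + \<kappa> / b n) \<longlonglongrightarrow> 0"
      by (intro tendsto_add_zero ratio_sub that(1) pos real_tendsto_divide_at_top[OF tendsto_const that(2)])
    show "\<forall>\<^sub>F n in sequentially. norm (a n / b n - 1) \<le> (b (Suc n) - b n) / b n + \<kappa> / b n"
      using pos
    proof eventually_elim
      case (elim n)
      then have "a n / b n - 1 = (a n - b n) / b n" by (simp add: field_simps)
      with elim have "norm (a n / b n - 1) = \<bar>a n - b n\<bar> / b n" by simp
      also have "\<dots> \<le> ((b (Suc n) - b n) + \<kappa>) / b n"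
        using that(3)[of n] elim by (intro divide_right_mono) auto
      finally show ?case by (simp add: add_divide_distrib)
    qed
  qed
  have "(\<lambda>n. lam (real n) / lam (real (Suc n))) \<longlonglongrightarrow> 1 \<and> (\<lambda>n. W n / lam (real n)) \<longlonglongrightarrow> 1"
    using ratio
  proof
    assume *: "(\<lambda>n. lam (real n) / lam (real (Suc n))) \<longlonglongrightarrow> 1"
    moreover have "\<bar>W n - lam (real n)\<bar> \<le> (lam (real (Suc n)) - lam (real n)) + \<kappa>" for n
      using W(1,2)[of n] W(3) lam_mono[of "real n" "real (Suc n)"] \<sigma> by (auto simp: abs_if split: if_splits)
    ultimately show ?thesis using near[OF * lam_n] by blast
  next
    assume *: "(\<lambda>n. W n / W (Suc n)) \<longlonglongrightarrow> 1"
    \<comment> \<open>Up to \<kappa>, \<open>lam (real (Suc n))\<close> lies between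
      \<open>W n\<close> and \<open>W (Suc n)\<close>. So it is equivalent to both of them, and both
      claims follow by shifting the index.\<close>
    have "\<bar>lam (real (Suc n)) - W n\<bar> \<le> (W (Suc n) - W n) + \<kappa>" for n
      using W(1,2)[of n] W(1)[of "Suc n"] W(3) W_mono[of n] \<sigma> by (auto simp: abs_if split: if_splits)
    from near[OF * W_n this] have l: "(\<lambda>n. lam (real (Suc n)) / W n) \<longlonglongrightarrow> 1" .
    have "(\<lambda>n. lam (real (Suc n)) / W (Suc n)) \<longlonglongrightarrow> 1"
      by (rule ratio_trans_tendsto_1[OF l * pos(2)])
    then have l': "(\<lambda>n. lam (real n) / W n) \<longlonglongrightarrow> 1" by (rule LIMSEQ_imp_Suc)
    have "(\<lambda>n. lam (real n) / lam (real (Suc n))) \<longlonglongrightarrow> 1"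
      by (rule ratio_trans_tendsto_1[OF l' ratio_inverse_tendsto_1[OF l] pos(2)])
    with ratio_inverse_tendsto_1[OF l'] show ?thesis by blast
  qed
  then show "(\<lambda>n. lam (real n) / lam (real (Suc n))) \<longlonglongrightarrow> 1" "(\<lambda>n. W n / lam (real n)) \<longlonglongrightarrow> 1"
    by blast+
qed

text \<open>
  \<open>B'\<close> has the law of \<open>B\<close>. The bounds \<open>upper\<close> and \<open>lower\<close> compare \<open>A\<close> with \<open>B\<close> on one side and with
  \<open>B'\<close> on the other, so the two signed excesses must be transferred separately.
\<close>

lemma (in prob_space) converges_iff_sandwich:
  fixes A :: "real \<Rightarrow> 'a \<Rightarrow> real" and lam :: "real \<Rightarrow> real" and W :: "nat \<Rightarrow> real"
  assumes m: "valid_mode m" and \<sigma>: "\<bar>\<sigma>\<bar> = 1"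
    and A_meas: "\<And>t. 0 \<le> t \<Longrightarrow> A t \<in> borel_measurable M"
    and B_meas: "\<And>n. B n \<in> borel_measurable M" "\<And>n. B' n \<in> borel_measurable M"
    and A_mono: "\<And>\<omega> s t. \<omega> \<in> space M \<Longrightarrow> 0 \<le> s \<Longrightarrow> s \<le> t \<Longrightarrow> A s \<omega> \<le> A t \<omega>"
    and lam_mono: "\<And>s t. 0 \<le> s \<Longrightarrow> s \<le> t \<Longrightarrow> lam s \<le> lam t"
    and lam_top: "filterlim lam at_top at_top"
    and W_mono: "\<And>n. W n \<le> W (Suc n)"
    and W: "\<And>n. \<sigma> * lam (real n) \<le> \<sigma> * W n" "\<And>n. \<sigma> * W n \<le> \<sigma> * lam (real (Suc n)) + \<kappa>" "0 \<le> \<kappa>"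
    and upper: "\<And>n \<omega>. \<omega> \<in> space M \<Longrightarrow> \<sigma> * A (real n) \<omega> \<le> \<sigma> * B n \<omega>"
    and lower: "\<And>n \<omega>. \<omega> \<in> space M \<Longrightarrow> \<sigma> * B' n \<omega> \<le> \<sigma> * A (real (Suc n)) \<omega> + U \<omega>"
    and U_meas: "U \<in> borel_measurable M"
    and U: "\<And>\<omega>. \<omega> \<in> space M \<Longrightarrow> 0 \<le> U \<omega>"
      "\<And>n \<omega>. \<omega> \<in> space M \<Longrightarrow> 1 \<le> n \<Longrightarrow> U \<omega> \<le> K * A (real n) \<omega>"
      "\<And>n \<omega>. \<omega> \<in> space M \<Longrightarrow> 1 \<le> n \<Longrightarrow> U \<omega> \<le> K * B n \<omega>"
    and law: "\<And>\<tau>. vanishes m M (excess \<tau> B W) sequentially \<longleftrightarrow> vanishes m M (excess \<tau> B' W) sequentially"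
    and ratio_A: "converges m M (\<lambda>n \<omega>. A (real n) \<omega> / lam (real n)) 1 sequentially \<Longrightarrow>
      (\<lambda>n. lam (real n) / lam (real (Suc n))) \<longlonglongrightarrow> 1"
    and ratio_B: "converges m M (\<lambda>n \<omega>. B n \<omega> / W n) 1 sequentially \<Longrightarrow> (\<lambda>n. W n / W (Suc n)) \<longlonglongrightarrow> 1"
  shows "converges m M (\<lambda>t \<omega>. A t \<omega> / lam t) 1 at_top \<longleftrightarrow>
    converges m M (\<lambda>n \<omega>. B n \<omega> / W n) 1 sequentially"
proof -
  note [measurable] = B_meas U_meas
  have M: "finite_measure M" by unfold_locales
  have \<sigma>': "\<bar>- \<sigma>\<bar> = 1" using \<sigma> by simp
  let ?A = "\<lambda>n::nat. A (real n)" and ?lam = "\<lambda>n::nat. lam (real n)"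
  have [measurable]: "?A n \<in> borel_measurable M" for n by (rule A_meas) simp
  have lam_n: "filterlim ?lam at_top sequentially"
    by (rule filterlim_compose[OF lam_top filterlim_real_sequentially])
  have ev_A: "\<forall>\<^sub>F t in at_top. A t \<in> borel_measurable M"
    using eventually_ge_at_top[of "0::real"] by eventually_elim (rule A_meas)
  \<comment> \<open>\<open>Y\<close> and \<open>b\<close> stand for whichever quotient is known to
    converge. Its convergence makes \<open>U\<close> negligible against any diverging normaliser, so
    one argument covers both implications.\<close>
  have main: "converges m M (\<lambda>t \<omega>. A t \<omega> / lam t) 1 at_top \<longleftrightarrow>
      converges m M (\<lambda>n \<omega>. B n \<omega> / W n) 1 sequentially"
    if ratio: "(\<lambda>n. ?lam n / ?lam (Suc n)) \<longlonglongrightarrow> 1" "(\<lambda>n. W n / ?lam n) \<longlonglongrightarrow> 1"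
      and Y: "converges m M (\<lambda>n \<omega>. Y n \<omega> / b n) 1 sequentially" "\<And>n. Y n \<in> borel_measurable M"
        "filterlim b at_top sequentially"
        "\<And>n \<omega>. \<omega> \<in> space M \<Longrightarrow> 1 \<le> n \<Longrightarrow> U \<omega> \<le> K * Y n \<omega>"
    for Y :: "nat \<Rightarrow> 'a \<Rightarrow> real" and b
  proof -
    have W_n: "filterlim W at_top sequentially"
    proof (rule filterlim_at_top_mono)
      have "filterlim (\<lambda>n. (W n / ?lam n) * ?lam n) at_top sequentially"
        by (rule filterlim_tendsto_pos_mult_at_top[OF ratio(2) _ lam_n]) simp
      then show "filterlim (\<lambda>n. (W n / ?lam n) * ?lam n) at_top sequentially" .
      have "\<forall>\<^sub>F n in sequentially. ?lam n > 0" using lam_n by (simp add: filterlim_at_top_dense)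
      then show "\<forall>\<^sub>F n in sequentially. W n / ?lam n * ?lam n \<le> W n" by eventually_elim simp
    qed
    have pos: "\<forall>\<^sub>F n in sequentially. ?lam n > 0" "\<forall>\<^sub>F n in sequentially. W n > 0"
      "\<forall>\<^sub>F t in at_top. lam t > 0"
      using lam_n W_n lam_top by (simp_all add: filterlim_at_top_dense)
    have U0: "vanishes m M (\<lambda>i \<omega>. U \<omega> / b' i) F" if "filterlim b' at_top F"
      for b' :: "'i \<Rightarrow> real" and F
      by (rule vanishes_over_normaliser[OF m Y(1,2) U_meas Y(3) U(1) Y(4) that])
    note transfer_U = vanishes_excess_transfer[OF m _ _ _ U0 U_meas U(1)]
    \<comment> \<open>Setting the error to \<open>0\<close> gives \<open>transfer\<close>, for
      comparisons without error; \<open>transfer_U\<close> is for those in which \<open>U\<close>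
      remains.\<close>
    have Z0: "vanishes m M (\<lambda>i \<omega>. 0 / b' i) F" for b' :: "'i \<Rightarrow> real" and F
      using vanishes_const[OF m tendsto_const[of 0 F]] by simp
    note transfer = vanishes_excess_transfer[OF m _ _ _ Z0, simplified]
    let ?n = "\<lambda>t::real. nat \<lfloor>t\<rfloor>"
    have A_meas': "\<forall>\<^sub>F t in F. ?A (g t) \<in> borel_measurable M" for g :: "'i \<Rightarrow> nat" and F
      by (intro always_eventually allI A_meas) simp
    have n_top: "filterlim ?n sequentially at_top"
      by (intro filterlim_compose[OF filterlim_nat_sequentially filterlim_floor_sequentially])
    have n_bounds: "\<forall>\<^sub>F t in at_top. real (?n t) \<le> t \<and> t \<le> real (Suc (?n t))"
      using eventually_ge_at_top[of "0::real"] by eventually_elim linarith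
    have lam_ratio: "((\<lambda>t. ?lam (?n t) / lam t) \<longlongrightarrow> 1) at_top"
    proof (rule tendsto_sandwich)
      show "((\<lambda>t. ?lam (?n t) / ?lam (Suc (?n t))) \<longlongrightarrow> 1) at_top"
        by (rule filterlim_compose[OF ratio(1) n_top])
      show "((\<lambda>_. 1) \<longlongrightarrow> (1::real)) (at_top :: real filter)" by simp
      have "\<forall>\<^sub>F t in at_top. ?lam (?n t) > 0" by (rule eventually_compose_filterlim[OF pos(1) n_top])
      then have "\<forall>\<^sub>F t in at_top. 0 < ?lam (?n t) \<and> ?lam (?n t) \<le> lam t \<and> lam t \<le> ?lam (Suc (?n t))"
        using n_bounds eventually_ge_at_top[of 0] by eventually_elim (auto intro: lam_mono)
      then show "\<forall>\<^sub>F t in at_top. ?lam (?n t) / ?lam (Suc (?n t)) \<le> ?lam (?n t) / lam t"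
        "\<forall>\<^sub>F t in at_top. ?lam (?n t) / lam t \<le> 1"
        by (eventually_elim, auto intro!: divide_left_mono mult_pos_pos)+
    qed
    have lam_ratio': "((\<lambda>t. ?lam (Suc (?n t)) / lam t) \<longlongrightarrow> 1) at_top"
      by (rule ratio_trans_tendsto_1[OF filterlim_compose[OF ratio_inverse_tendsto_1[OF ratio(1)] n_top]
            lam_ratio eventually_compose_filterlim[OF pos(1) n_top]])
    have A_t: "vanishes m M (excess \<tau> A lam) at_top" if "\<bar>\<tau>\<bar> = 1" "vanishes m M (excess \<tau> ?A ?lam) sequentially" for \<tau>
    \<comment> \<open>As \<open>A\<close> is nondecreasing in time, its upper excess at
      \<open>t\<close> is controlled from the next integer and its lower excess from the preceding
      one.\<close>
    proof (cases "\<tau> = 1")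
      case True
      have S: "filterlim (\<lambda>t. Suc (?n t)) sequentially at_top"
        by (rule filterlim_compose[OF filterlim_Suc n_top])
      have "vanishes m M (excess \<tau> (\<lambda>t. ?A (Suc (?n t))) (\<lambda>t. ?lam (Suc (?n t)))) at_top"
        using vanishes_excess_compose[OF that(2) S] .
      then show ?thesis
      proof (rule transfer[OF that(1)])
        show "\<forall>\<^sub>F t in at_top. \<forall>\<omega>\<in>space M. \<tau> * A t \<omega> \<le> \<tau> * ?A (Suc (?n t)) \<omega>"
          using n_bounds eventually_ge_at_top[of 0]
          by eventually_elim (use True in \<open>auto intro!: A_mono\<close>)
      qed (fact A_meas' lam_ratio' pos(3) eventually_compose_filterlim[OF pos(1) S])+
    next
      case False
      with that(1) have \<tau>: "\<tau> = -1" by linarith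
      have "vanishes m M (excess \<tau> (\<lambda>t. ?A (?n t)) (\<lambda>t. ?lam (?n t))) at_top"
        using vanishes_excess_compose[OF that(2) n_top] .
      then show ?thesis
      proof (rule transfer[OF that(1)])
        show "\<forall>\<^sub>F t in at_top. \<forall>\<omega>\<in>space M. \<tau> * A t \<omega> \<le> \<tau> * ?A (?n t) \<omega>"
          using n_bounds eventually_ge_at_top[of 0]
          by eventually_elim (use \<tau> in \<open>auto intro!: A_mono\<close>)
      qed (fact A_meas' lam_ratio pos(3) eventually_compose_filterlim[OF pos(1) n_top])+
    qed
    have A_n: "vanishes m M (excess \<tau> ?A ?lam) sequentially" if "vanishes m M (excess \<tau> A lam) at_top" for \<tau>
      using vanishes_excess_compose[OF that filterlim_real_sequentially] .
    \<comment> \<open>\<open>lower\<close> relates \<open>A\<close> at \<open>n\<close> to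
      \<open>B'\<close> at \<open>n - 1\<close>. Truncated subtraction matters at
      \<open>n = 0\<close> only, which is excluded below by \<open>1 \<le> n\<close>.\<close>
    have pred: "filterlim (\<lambda>n::nat. n - 1) sequentially sequentially"
      by (rule filterlim_minus_const_nat_at_top)
    have pred_ratio: "(\<lambda>n. W (n - 1) / ?lam n) \<longlonglongrightarrow> 1"
      by (rule LIMSEQ_imp_Suc) (use ratio_trans_tendsto_1[OF ratio(2,1) pos(1)] in simp)
    have iff_A: "converges m M (\<lambda>t \<omega>. A t \<omega> / lam t) 1 at_top \<longleftrightarrow>
        vanishes m M (excess \<sigma> A lam) at_top \<and> vanishes m M (excess (- \<sigma>) A lam) at_top"
      by (rule converges_iff_excess[OF m M \<sigma> ev_A])
    have iff_B: "converges m M (\<lambda>n \<omega>. B n \<omega> / W n) 1 sequentially \<longleftrightarrow>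
        vanishes m M (excess \<sigma> B W) sequentially \<and> vanishes m M (excess (- \<sigma>) B W) sequentially"
      by (rule converges_iff_excess[OF m M \<sigma>]) simp
    show ?thesis
    proof
      assume "converges m M (\<lambda>t \<omega>. A t \<omega> / lam t) 1 at_top"
      then have A: "vanishes m M (excess \<sigma> ?A ?lam) sequentially"
        "vanishes m M (excess (- \<sigma>) ?A ?lam) sequentially"
        using iff_A by (blast intro: A_n)+
      \<comment> \<open>\<open>upper\<close> settles the sign \<open>- \<sigma>\<close> for
        \<open>B\<close> directly. The sign \<sigma> is settled for \<open>B'\<close> by
        \<open>lower\<close>, and \<open>law\<close> carries it over to \<open>B\<close>.\<close>
      have "vanishes m M (excess (- \<sigma>) B W) sequentially"
        using A(2) by (rule transfer[OF \<sigma>'])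
          (use upper ratio_inverse_tendsto_1[OF ratio(2)] pos in auto)
      moreover have "vanishes m M (excess \<sigma> (\<lambda>n. ?A (Suc n)) (\<lambda>n. ?lam (Suc n))) sequentially"
        using vanishes_excess_compose[OF A(1) filterlim_Suc] .
      then have "vanishes m M (excess \<sigma> B' W) sequentially"
      proof (rule transfer_U[OF \<sigma> _ _ W_n])
        show "(\<lambda>n. ?lam (Suc n) / W n) \<longlonglongrightarrow> 1"
          by (rule ratio_trans_tendsto_1[OF ratio_inverse_tendsto_1[OF ratio(1)]
                ratio_inverse_tendsto_1[OF ratio(2)] pos(1)])
        show "\<forall>\<^sub>F n in sequentially. 0 < ?lam (Suc n)"
          by (rule eventually_compose_filterlim[OF pos(1) filterlim_Suc])
        show "\<forall>\<^sub>F n in sequentially. \<forall>\<omega>\<in>space M. \<sigma> * B' n \<omega> \<le> \<sigma> * ?A (Suc n) \<omega> + U \<omega>"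
          using lower by simp
        show "\<forall>\<^sub>F n in sequentially. ?A (Suc n) \<in> borel_measurable M" by (rule A_meas')
        show "\<forall>\<^sub>F n in sequentially. 0 < W n" by (rule pos(2))
      qed
      ultimately show "converges m M (\<lambda>n \<omega>. B n \<omega> / W n) 1 sequentially"
        using iff_B law by blast
    next
      assume "converges m M (\<lambda>n \<omega>. B n \<omega> / W n) 1 sequentially"
      then have B: "vanishes m M (excess \<sigma> B W) sequentially"
        "vanishes m M (excess (- \<sigma>) B' W) sequentially"
        using iff_B law by blast+
      \<comment> \<open>Here \<open>upper\<close> settles the sign \<sigma>. For
        \<open>- \<sigma>\<close> the sum \<open>B\<close> has already been replaced by
        \<open>B'\<close>, which \<open>lower\<close> compares with \<open>A\<close> one step
        later.\<close>
      have "vanishes m M (excess \<sigma> ?A ?lam) sequentially"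
        using B(1) by (rule transfer[OF \<sigma>]) (use upper ratio(2) pos in auto)
      moreover have "vanishes m M (excess (- \<sigma>) (\<lambda>n. B' (n - 1)) (\<lambda>n. W (n - 1))) sequentially"
        using vanishes_excess_compose[OF B(2) pred] .
      then have "vanishes m M (excess (- \<sigma>) ?A ?lam) sequentially"
      proof (rule transfer_U[OF \<sigma>' _ _ lam_n])
        show "\<forall>\<^sub>F n in sequentially. \<forall>\<omega>\<in>space M. - \<sigma> * ?A n \<omega> \<le> - \<sigma> * B' (n - 1) \<omega> + U \<omega>"
          using eventually_ge_at_top[of 1]
        proof (eventually_elim, intro ballI)
          fix n :: nat and \<omega> assume "1 \<le> n" "\<omega> \<in> space M"
          then show "- \<sigma> * ?A n \<omega> \<le> - \<sigma> * B' (n - 1) \<omega> + U \<omega>"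
            using lower[of \<omega> "n - 1"] by simp
        qed
        show "\<forall>\<^sub>F n in sequentially. 0 < W (n - 1)"
          by (rule eventually_compose_filterlim[OF pos(2) pred])
        show "\<forall>\<^sub>F n in sequentially. B' (n - 1) \<in> borel_measurable M" by simp
        show "\<forall>\<^sub>F n in sequentially. 0 < ?lam n" by (rule pos(1))
      qed (assumption | rule pred_ratio)+
      ultimately show "converges m M (\<lambda>t \<omega>. A t \<omega> / lam t) 1 at_top"
        using iff_A A_t \<sigma> \<sigma>' by blast
    qed
  qed
  note equiv = normalisers_equivalent[OF \<sigma> lam_mono lam_top W_mono W]
  show ?thesis
  proof
    assume *: "converges m M (\<lambda>t \<omega>. A t \<omega> / lam t) 1 at_top"
    have A: "converges m M (\<lambda>n \<omega>. ?A n \<omega> / ?lam n) 1 sequentially"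
      using converges_compose[OF * filterlim_real_sequentially] .
    have "converges m M (\<lambda>t \<omega>. A t \<omega> / lam t) 1 at_top \<longleftrightarrow>
        converges m M (\<lambda>n \<omega>. B n \<omega> / W n) 1 sequentially"
      by (rule main[OF equiv A _ lam_n U(2)]) (use ratio_A[OF A] in auto)
    with * show "converges m M (\<lambda>n \<omega>. B n \<omega> / W n) 1 sequentially" by blast
  next
    assume *: "converges m M (\<lambda>n \<omega>. B n \<omega> / W n) 1 sequentially"
    \<comment> \<open>\<open>main\<close> with \<open>b = W\<close> asks for divergence of
      \<open>W\<close>, which is inherited from \<open>lam\<close> through their
      equivalence.\<close>
    have r: "(\<lambda>n. W n / ?lam n) \<longlonglongrightarrow> 1" by (rule equiv(2)) (use ratio_B[OF *] in auto)
    have "filterlim (\<lambda>n. (W n / ?lam n) * ?lam n) at_top sequentially"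
      by (rule filterlim_tendsto_pos_mult_at_top[OF r _ lam_n]) simp
    moreover have "\<forall>\<^sub>F n in sequentially. ?lam n > 0" using lam_n by (simp add: filterlim_at_top_dense)
    then have "\<forall>\<^sub>F n in sequentially. W n / ?lam n * ?lam n \<le> W n" by eventually_elim simp
    ultimately have W_n: "filterlim W at_top sequentially" by (rule filterlim_at_top_mono)
    have "converges m M (\<lambda>t \<omega>. A t \<omega> / lam t) 1 at_top \<longleftrightarrow>
        converges m M (\<lambda>n \<omega>. B n \<omega> / W n) 1 sequentially"
      by (rule main[OF equiv * _ W_n U(3)]) (use ratio_B[OF *] in auto)
    with * show "converges m M (\<lambda>t \<omega>. A t \<omega> / lam t) 1 at_top" by blast
  qed
qed

section \<open>Integrals of monotone functions against interval measures\<close>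

text \<open>Freezing the function at its value at \<open>0\<close> on the negative axis makes it
  monotone on the whole line.\<close>

lemma mono_on_borel_measurable_max:
  fixes f :: "real \<Rightarrow> real"
  assumes "mono_on {0..} f"
  shows "(\<lambda>x. f (max 0 x)) \<in> borel_measurable borel"
  using assms by (intro borel_measurable_mono) (auto simp: mono_def mono_on_def)

text \<open>Instances are the extended paths \<open>\<lambda>s. S (max 0 s) \<omega>\<close> and the
  identity, so the same Riemann sum inequalities serve the stochastic integral and its
  normaliser.\<close>

locale nondecreasing_integrator =
  fixes F :: "real \<Rightarrow> real"
  assumes mono: "\<And>x y. x \<le> y \<Longrightarrow> F x \<le> F y"
    and right_continuous: "\<And>a. continuous (at_right a) F"
begin

text \<open>On the interval the function stays between \<open>f 0\<close> and \<open>f b\<close>,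
  and the interval has finite mass.\<close>

lemma set_integrable_Ioc:
  fixes f :: "real \<Rightarrow> real"
  assumes f: "mono_on {0..} f" and a: "0 \<le> a"
  shows "set_integrable (interval_measure F) {a<..b} f"
  unfolding set_integrable_def
proof (rule Bochner_Integration.integrable_bound)
  show "integrable (interval_measure F) (\<lambda>x. max \<bar>f 0\<bar> \<bar>f b\<bar> * indicator {a<..b} x)"
    by (intro integrable_mult_right integrable_real_indicator)
       (auto simp: emeasure_interval_measure_Ioc_eq mono right_continuous)
  have "(\<lambda>x. indicator {a<..b} x *\<^sub>R f x) = (\<lambda>x. indicator {a<..b} x *\<^sub>R f (max 0 x))"
    using a by (auto simp: indicator_def fun_eq_iff)
  then show "(\<lambda>x. indicator {a<..b} x *\<^sub>R f x) \<in> borel_measurable (interval_measure F)"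
    using mono_on_borel_measurable_max[OF f] by simp
  show "AE x in interval_measure F. norm (indicator {a<..b} x *\<^sub>R f x)
      \<le> norm (max \<bar>f 0\<bar> \<bar>f b\<bar> * indicator {a<..b} x)"
  proof (intro AE_I2)
    fix x
    have "\<bar>f x\<bar> \<le> max \<bar>f 0\<bar> \<bar>f b\<bar>" if "a < x" "x \<le> b"
      using mono_onD[OF f, of 0 x] mono_onD[OF f, of x b] that a by auto
    then show "norm (indicator {a<..b} x *\<^sub>R f x) \<le> norm (max \<bar>f 0\<bar> \<bar>f b\<bar> * indicator {a<..b} x)"
      by (auto simp: indicator_def)
  qed
qed

lemma integral_Ioc_bounds:
  fixes f :: "real \<Rightarrow> real"
  assumes f: "mono_on {0..} f" and a: "0 \<le> a" "a \<le> b"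
  shows "f a * (F b - F a) \<le> (LINT x:{a<..b}|interval_measure F. f x)"
    and "(LINT x:{a<..b}|interval_measure F. f x) \<le> f b * (F b - F a)"
proof -
  have const: "set_integrable (interval_measure F) {a<..b} (\<lambda>_. c)" for c :: real
    by (rule set_integrable_Ioc) (auto simp: mono_on_def a)
  have eq: "(LINT x:{a<..b}|interval_measure F. c) = c * (F b - F a)" for c :: real
    by (simp add: set_lebesgue_integral_def measure_interval_measure_Ioc a mono right_continuous)
  have "(LINT x:{a<..b}|interval_measure F. f a) \<le> (LINT x:{a<..b}|interval_measure F. f x)"
    by (intro set_integral_mono const set_integrable_Ioc f a) (use a in \<open>auto intro: mono_onD[OF f]\<close>)
  then show "f a * (F b - F a) \<le> (LINT x:{a<..b}|interval_measure F. f x)" by (simp add: eq)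
  have "(LINT x:{a<..b}|interval_measure F. f x) \<le> (LINT x:{a<..b}|interval_measure F. f b)"
    by (intro set_integral_mono const set_integrable_Ioc f a) (use a in \<open>auto intro: mono_onD[OF f]\<close>)
  then show "(LINT x:{a<..b}|interval_measure F. f x) \<le> f b * (F b - F a)" by (simp add: eq)
qed

text \<open>The factor \<open>c\<close> covers both directions of monotonicity; integrability of
  \<open>f\<close> is recovered from that of \<open>c * f\<close> by scaling with
  \<open>1 / c\<close>.\<close>

lemma integral_Ioc_combine:
  fixes f :: "real \<Rightarrow> real"
  assumes f: "mono_on {0..} (\<lambda>x. c * f x)" "c \<noteq> 0" and a: "0 \<le> a" "a \<le> b" "b \<le> d"
  shows "(LINT x:{a<..d}|interval_measure F. f x) =
    (LINT x:{a<..b}|interval_measure F. f x) + (LINT x:{b<..d}|interval_measure F. f x)"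
proof -
  have int: "set_integrable (interval_measure F) {s<..t} f" if "0 \<le> s" for s t
    using set_integrable_mult_right[of "1 / c", OF set_integrable_Ioc[OF f(1) that]] f(2) by simp
  have "{a<..d} = {a<..b} \<union> {b<..d}" using a by auto
  then show ?thesis using int a by (simp add: set_integral_Un)
qed

text \<open>Right endpoints overestimate an increasing integrand and underestimate a decreasing one.
  A factor \<open>c\<close> on both sides puts the two cases into the same pair of inequalities,
  proved by adding the bounds over single intervals.\<close>

lemma riemann_sum_bounds:
  fixes f :: "real \<Rightarrow> real"
  assumes f: "mono_on {0..} (\<lambda>x. c * f x)" "c \<noteq> 0"
    and \<tau>: "0 \<le> \<tau> 0" "\<And>i. i < n \<Longrightarrow> \<tau> i \<le> \<tau> (Suc i)"
  shows "c * (LINT x:{\<tau> 0<..\<tau> n}|interval_measure F. f x)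
      \<le> c * (\<Sum>i<n. f (\<tau> (Suc i)) * (F (\<tau> (Suc i)) - F (\<tau> i)))" (is "?upper n")
    and "c * (\<Sum>i<n. f (\<tau> i) * (F (\<tau> (Suc i)) - F (\<tau> i)))
      \<le> c * (LINT x:{\<tau> 0<..\<tau> n}|interval_measure F. f x)" (is "?lower n")
proof -
  have "?upper n \<and> ?lower n \<and> \<tau> 0 \<le> \<tau> n"
    using \<tau>(2)
  proof (induction n)
    case 0
    then show ?case by (simp add: set_lebesgue_integral_def)
  next
    case (Suc n)
    then have IH: "?upper n" "?lower n" "\<tau> 0 \<le> \<tau> n" by auto
    have le: "0 \<le> \<tau> n" "\<tau> n \<le> \<tau> (Suc n)" using IH(3) \<tau>(1) Suc.prems by auto
    have step: "(LINT x:{\<tau> 0<..\<tau> (Suc n)}|interval_measure F. f x) =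
      (LINT x:{\<tau> 0<..\<tau> n}|interval_measure F. f x) + (LINT x:{\<tau> n<..\<tau> (Suc n)}|interval_measure F. f x)"
      by (rule integral_Ioc_combine[OF f]) (use IH(3) le \<tau>(1) in auto)
    have "c * f (\<tau> n) * (F (\<tau> (Suc n)) - F (\<tau> n)) \<le> c * (LINT x:{\<tau> n<..\<tau> (Suc n)}|interval_measure F. f x)"
      "c * (LINT x:{\<tau> n<..\<tau> (Suc n)}|interval_measure F. f x) \<le> c * f (\<tau> (Suc n)) * (F (\<tau> (Suc n)) - F (\<tau> n))"
      using integral_Ioc_bounds[OF f(1) le] by simp_all
    with IH le show ?case by (simp add: step distrib_left mult.assoc)
  qed
  then show "?upper n" "?lower n" by blast+
qed

end

section \<open>Integrals depending measurably on the integrator\<close>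

lemma measurable_emeasure_interval_measure:
  assumes F: "\<And>\<omega>. \<omega> \<in> space M \<Longrightarrow> nondecreasing_integrator (F \<omega>)"
    and meas [measurable]: "\<And>s. (\<lambda>\<omega>. F \<omega> s) \<in> borel_measurable M"
    and A: "A \<in> sets borel"
  shows "(\<lambda>\<omega>. emeasure (interval_measure (F \<omega>)) (A \<inter> {a<..b})) \<in> borel_measurable M"
proof -
  let ?\<mu> = "\<lambda>\<omega>. interval_measure (F \<omega>)"
  have Ioc: "(\<lambda>\<omega>. emeasure (?\<mu> \<omega>) {a<..b}) \<in> borel_measurable M" for a b
  proof (subst measurable_cong)
    fix \<omega> assume "\<omega> \<in> space M"
    then interpret nondecreasing_integrator "F \<omega>" by (rule F)
    show "emeasure (?\<mu> \<omega>) {a<..b} = ennreal (if a \<le> b then F \<omega> b - F \<omega> a else 0)"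
      by (simp add: emeasure_interval_measure_Ioc_eq mono right_continuous)
  qed simp
  have borel: "sets (borel :: real measure) = sigma_sets UNIV (range atMost)"
    by (subst borel_eq_atMost) simp
  \<comment> \<open>Half-lines form an intersection-stable generator. Intersecting with
    \<open>{a<..b}\<close> keeps all masses finite, so that complements can be handled by
    subtraction.\<close>
  have "{..x} \<inter> {..y} = {..min x y}" for x y :: real by auto
  then have "Int_stable (range (atMost :: real \<Rightarrow> real set))" by (auto simp: Int_stable_def)
  moreover have "range (atMost :: real \<Rightarrow> real set) \<subseteq> Pow UNIV" by simp
  moreover have "A \<in> sigma_sets UNIV (range atMost)" using A borel by simp
  ultimately show ?thesis
  proof (induction A rule: sigma_sets_induct_disjoint)
    case (basic A)
    then obtain c where "A = {..c}" by auto
    then have "A \<inter> {a<..b} = {a<..min b c}" by auto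
    then show ?case by (simp only: Ioc)
  next
    case empty
    then show ?case by simp
  next
    case (compl A)
    then have A: "A \<in> sets borel" by (simp add: borel)
    have "emeasure (?\<mu> \<omega>) ((UNIV - A) \<inter> {a<..b}) =
        emeasure (?\<mu> \<omega>) {a<..b} - emeasure (?\<mu> \<omega>) (A \<inter> {a<..b})" if "\<omega> \<in> space M" for \<omega>
    proof -
      interpret nondecreasing_integrator "F \<omega>" using that by (rule F)
      have "emeasure (?\<mu> \<omega>) ({a<..b} - A \<inter> {a<..b}) =
          emeasure (?\<mu> \<omega>) {a<..b} - emeasure (?\<mu> \<omega>) (A \<inter> {a<..b})"
      proof (rule emeasure_Diff)
        have "emeasure (?\<mu> \<omega>) (A \<inter> {a<..b}) \<le> emeasure (?\<mu> \<omega>) {a<..b}" by (rule emeasure_mono) auto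
        then show "emeasure (?\<mu> \<omega>) (A \<inter> {a<..b}) \<noteq> \<infinity>"
          by (auto simp: emeasure_interval_measure_Ioc_eq mono right_continuous top_unique split: if_splits)
      qed (use A in auto)
      moreover have "(UNIV - A) \<inter> {a<..b} = {a<..b} - A \<inter> {a<..b}" by auto
      ultimately show ?thesis by simp
    qed
    then show ?case using compl Ioc by (simp cong: measurable_cong)
  next
    case (union A)
    then have A: "A i \<in> sets borel" for i by (auto simp: borel)
    have "emeasure (?\<mu> \<omega>) ((\<Union>i. A i) \<inter> {a<..b}) = (\<Sum>i. emeasure (?\<mu> \<omega>) (A i \<inter> {a<..b}))" for \<omega>
      using union(1) A by (subst suminf_emeasure) (auto simp: disjoint_family_on_def)
    then show ?case using union by simp
  qed
qed

text \<open>The usual extension from indicators through linear combinations and monotone limits. The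
  factor \<open>indicator {a<..b} x\<close> is kept throughout, so the base case is the
  measurability of masses.\<close>

lemma measurable_nn_integral_interval_measure:
  assumes F: "\<And>\<omega>. \<omega> \<in> space M \<Longrightarrow> nondecreasing_integrator (F \<omega>)"
    and meas: "\<And>s. (\<lambda>\<omega>. F \<omega> s) \<in> borel_measurable M"
    and g: "g \<in> borel_measurable borel"
  shows "(\<lambda>\<omega>. \<integral>\<^sup>+x. g x * indicator {a<..b} x \<partial>interval_measure (F \<omega>)) \<in> borel_measurable M"
  using g
proof (induction g rule: borel_measurable_induct)
  case (cong f g)
  then show ?case by simp
next
  case (set A)
  have "(\<integral>\<^sup>+x. indicator A x * indicator {a<..b} x \<partial>interval_measure (F \<omega>)) =
      emeasure (interval_measure (F \<omega>)) (A \<inter> {a<..b})" for \<omega>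
    using set by (simp flip: indicator_inter_arith)
  then show ?case using measurable_emeasure_interval_measure[OF F meas set] by simp
next
  case (mult u c)
  then show ?case by (simp add: mult.assoc nn_integral_cmult)
next
  case (add u v)
  then show ?case by (simp add: distrib_right nn_integral_add)
next
  case (seq U)
  have "(\<integral>\<^sup>+x. (SUP i. U i) x * indicator {a<..b} x \<partial>interval_measure (F \<omega>)) =
      (SUP i. \<integral>\<^sup>+x. U i x * indicator {a<..b} x \<partial>interval_measure (F \<omega>))" for \<omega>
  proof -
    have "(SUP i. U i) x * indicator {a<..b} x = (SUP i. U i x * indicator {a<..b} x)" for x
      unfolding SUP_apply by (rule SUP_mult_right_ennreal)
    moreover have "incseq (\<lambda>i x. U i x * indicator {a<..b} x)"
      using \<open>incseq U\<close> by (auto simp: incseq_def le_fun_def intro!: mult_right_mono)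
    ultimately show ?thesis
      using seq(1) by (simp only:) (rule nn_integral_monotone_convergence_SUP; simp)
  qed
  then show ?case using seq by simp
qed

text \<open>Lebesgue measure is the interval measure of the identity, and the additional endpoint
  \<open>0\<close> is a null set.\<close>

lemma lebesgue_int_eq_interval_measure:
  "lebesgue_int f t = (LINT x:{0<..t}|interval_measure (\<lambda>x. x). f x)"
  unfolding lebesgue_int_def lborel_eq_real[symmetric] set_lebesgue_integral_def
  by (rule integral_discrete_difference[where X="{0}"]) (auto simp: indicator_def)

section \<open>The Gamma process\<close>

lemma (in nondecreasing_integrator) integral_Ioc_nondecreasing:
  fixes f :: "real \<Rightarrow> real"
  assumes f: "mono_on {0..} (\<lambda>x. c * f x)" "c \<noteq> 0" "\<And>x. 0 \<le> x \<Longrightarrow> 0 \<le> f x"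
    and st: "0 \<le> s" "s \<le> t"
  shows "(LINT x:{0<..s}|interval_measure F. f x) \<le> (LINT x:{0<..t}|interval_measure F. f x)"
proof -
  have "0 \<le> (LINT x:{s<..t}|interval_measure F. f x)"
    unfolding set_lebesgue_integral_def
    by (intro integral_nonneg_AE AE_I2) (use st in \<open>auto simp: indicator_def intro!: f(3)\<close>)
  then show ?thesis using integral_Ioc_combine[OF f(1,2) _ st] by simp
qed

lemma nondecreasing_integrator_id: "nondecreasing_integrator (\<lambda>x. x)"
  by unfold_locales (auto intro: continuous_ident)

section \<open>The law of the sequence of unit increments\<close>

lemma (in levy_process) increments_indep:
  "indep_vars (\<lambda>_. borel) (\<lambda>i \<omega>. S (real (Suc (i + k))) \<omega> - S (real (i + k)) \<omega>) UNIV"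
  (is "indep_vars _ ?D _")
  unfolding indep_vars_def2
proof (intro conjI ballI)
  show "?D i \<in> borel_measurable M" for i by (intro borel_measurable_diff random_variable) auto
  show "indep_sets (\<lambda>i. {?D i -` A \<inter> space M |A. A \<in> sets borel}) UNIV"
  \<comment> \<open>Independence of an infinite family concerns its finite subfamilies, and each of
    these lies in an initial segment, where \<open>indep_increments\<close> applies.\<close>
  proof (subst indep_sets_finite_index_sets, intro allI impI)
    fix J :: "nat set" assume "finite J"
    then obtain n where n: "J \<subseteq> {..<n}" by (meson finite_nat_iff_bounded)
    have "indep_vars (\<lambda>_. borel) ?D {..<n}"
      using indep_increments[of "\<lambda>i. real (i + k)" n] by (simp add: mono_on_def)
    then have "indep_sets (\<lambda>i. {?D i -` A \<inter> space M |A. A \<in> sets borel}) {..<n}"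
      unfolding indep_vars_def2 by blast
    then show "indep_sets (\<lambda>i. {?D i -` A \<inter> space M |A. A \<in> sets borel}) J"
      using n by (rule indep_sets_mono_index[rotated])
  qed
qed

text \<open>Independence makes the joint law a product and stationarity makes its factors equal. The
  point is that the right-hand side does not depend on the shift \<open>k\<close>.\<close>

lemma (in levy_process) distr_increments:
  "distr M (Pi\<^sub>M UNIV (\<lambda>_. borel)) (\<lambda>\<omega> i. S (real (Suc (i + k))) \<omega> - S (real (i + k)) \<omega>) =
    Pi\<^sub>M UNIV (\<lambda>_. distr M borel (S 1))"
proof -
  let ?D = "\<lambda>i \<omega>. S (real (Suc (i + k))) \<omega> - S (real (i + k)) \<omega>"
  have "?D i \<in> borel_measurable M" for i by (intro borel_measurable_diff random_variable) auto
  then have "distr M (Pi\<^sub>M UNIV (\<lambda>_. borel)) (\<lambda>\<omega>. \<lambda>i\<in>UNIV. ?D i \<omega>) =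
      Pi\<^sub>M UNIV (\<lambda>i. distr M borel (?D i))"
    by (intro indep_vars_iff_distr_eq_PiM[THEN iffD1] increments_indep) auto
  moreover have "distr M borel (?D i) = distr M borel (S 1)" for i
    using stationary_increments[of "real (i + k)" 1] by (simp add: add_ac)
  ultimately show ?thesis by (simp add: restrict_UNIV)
qed

text \<open>Both sides apply the same functional \<open>?h\<close> to the unit increments, counted
  from time \<open>0\<close> and from time \<open>1\<close>, and these two increment sequences have
  the same law.\<close>

lemma (in levy_process) vanishes_weighted_sum_shift:
  fixes v b :: "nat \<Rightarrow> real"
  shows "vanishes m M (excess \<tau> (\<lambda>n \<omega>. \<Sum>i<n. v i * (S (real (Suc i)) \<omega> - S (real i) \<omega>)) b) sequentially \<longleftrightarrow>
    vanishes m M (excess \<tau> (\<lambda>n \<omega>. \<Sum>i<n. v i * (S (real (Suc (Suc i))) \<omega> - S (real (Suc i)) \<omega>)) b) sequentially"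
proof -
  let ?N = "Pi\<^sub>M UNIV (\<lambda>_::nat. borel :: real measure)"
  let ?h = "excess \<tau> (\<lambda>n x. \<Sum>i<n. v i * x i) b :: nat \<Rightarrow> (nat \<Rightarrow> real) \<Rightarrow> real"
  let ?X = "\<lambda>k \<omega> i. S (real (Suc (i + k))) \<omega> - S (real (i + k)) \<omega>"
  have "vanishes m (distr M ?N (?X k)) ?h sequentially \<longleftrightarrow>
      vanishes m M (\<lambda>n \<omega>. ?h n (?X k \<omega>)) sequentially" for k
  proof (rule vanishes_distr_iff)
    show "?X k \<in> measurable M ?N"
      by (intro measurable_PiM_single' borel_measurable_diff random_variable) auto
  qed measurable
  from this[of 0, unfolded distr_increments] this[of 1, unfolded distr_increments] show ?thesis
    by (simp add: excess_def[abs_def])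
qed

section \<open>Pathwise integrals as random variables\<close>

lemma (in gamma_process) path_integrator:
  assumes \<omega>: "\<omega> \<in> space M"
  shows "nondecreasing_integrator (\<lambda>s. S (max 0 s) \<omega>)"
proof
  show "S (max 0 x) \<omega> \<le> S (max 0 y) \<omega>" if "x \<le> y" for x y
    using mono_onD[OF increasing[OF \<omega>], of "max 0 x" "max 0 y"] that by auto
  show "continuous (at_right a) (\<lambda>s. S (max 0 s) \<omega>)" for a
  proof (cases "0 \<le> a")
    case True
    have "((\<lambda>s. S s \<omega>) \<longlongrightarrow> S a \<omega>) (at_right a)"
      using right_continuous[OF \<omega> True] by (simp add: continuous_within)
    then have "((\<lambda>s. S (max 0 s) \<omega>) \<longlongrightarrow> S a \<omega>) (at_right a)"
      by (rule Lim_transform_eventually)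
         (use True in \<open>auto simp: eventually_at_right_less intro: eventually_mono[OF eventually_at_right_less[of a]]\<close>)
    with True show ?thesis by (simp add: continuous_within)
  next
    case False
    then have "\<forall>\<^sub>F s in at_right a. s < 0" using eventually_at_right_real[of a 0] by (auto elim: eventually_mono)
    then have "\<forall>\<^sub>F s in at_right a. S (max 0 a) \<omega> = S (max 0 s) \<omega>"
      by eventually_elim (use False in simp)
    then have "((\<lambda>s. S (max 0 s) \<omega>) \<longlongrightarrow> S (max 0 a) \<omega>) (at_right a)"
      by (rule Lim_transform_eventually[OF tendsto_const])
    then show ?thesis by (simp add: continuous_within)
  qed
qed

text \<open>By nonnegativity the Bochner integral is the real value of a nonnegative integral, whose
  dependence on \<omega> is measurable. Passing to \<open>f (max 0 x)\<close> makes the integrand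
  Borel on the whole line and changes nothing on \<open>{0<..t}\<close>.\<close>

lemma (in gamma_process) measurable_stieltjes_int:
  assumes f: "mono_on {0..} (\<lambda>x. c * f x)" "c \<noteq> 0" "\<And>x. 0 \<le> x \<Longrightarrow> 0 \<le> f x"
  shows "stieltjes_int S f t \<in> borel_measurable M"
proof -
  let ?g = "\<lambda>x. f (max 0 x)"
  have g: "?g \<in> borel_measurable borel"
    using borel_measurable_times[OF borel_measurable_const mono_on_borel_measurable_max[OF f(1)], of "1 / c"] f(2)
    by simp
  have "stieltjes_int S f t \<omega> =
      enn2real (\<integral>\<^sup>+x. ennreal (?g x) * indicator {0<..t} x \<partial>interval_measure (\<lambda>s. S (max 0 s) \<omega>))" for \<omega>
  proof -
    have eq: "indicator {0<..t} x *\<^sub>R f x = indicator {0<..t} x * ?g x" for x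
      by (auto simp: indicator_def)
    have "stieltjes_int S f t \<omega> =
        enn2real (\<integral>\<^sup>+x. ennreal (indicator {0<..t} x * ?g x) \<partial>interval_measure (\<lambda>s. S (max 0 s) \<omega>))"
      unfolding stieltjes_int_def set_lebesgue_integral_def eq
      by (rule integral_eq_nn_integral) (use g f(3) in auto)
    also have "(\<lambda>x. ennreal (indicator {0<..t} x * ?g x)) = (\<lambda>x. ennreal (?g x) * indicator {0<..t} x)"
      by (auto simp: indicator_def)
    finally show ?thesis .
  qed
  moreover have "(\<lambda>\<omega>. \<integral>\<^sup>+x. ennreal (?g x) * indicator {0<..t} x \<partial>interval_measure (\<lambda>s. S (max 0 s) \<omega>))
      \<in> borel_measurable M"
    using g by (intro measurable_nn_integral_interval_measure path_integrator random_variable) auto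
  ultimately show ?thesis by (simp cong: measurable_cong)
qed

section \<open>Laplace transforms of increments and integrals\<close>

lemma (in gamma_process) laplace_increment:
  assumes "0 \<le> s" "0 \<le> h" "0 \<le> \<theta>"
  shows "expectation (\<lambda>\<omega>. exp (- \<theta> * (S (s + h) \<omega> - S s \<omega>))) = (1 + \<theta>) powr (- h)"
proof -
  have [measurable]: "S (s + h) \<in> borel_measurable M" "S s \<in> borel_measurable M" "S h \<in> borel_measurable M"
    using assms by (auto intro: random_variable)
  have "expectation (\<lambda>\<omega>. exp (- \<theta> * (S (s + h) \<omega> - S s \<omega>))) =
      (LINT x|distr M borel (\<lambda>\<omega>. S (s + h) \<omega> - S s \<omega>). exp (- \<theta> * x))"
    by (subst integral_distr) auto
  also have "\<dots> = (LINT x|distr M borel (S h). exp (- \<theta> * x))"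
    using stationary_increments[OF assms(1,2)] by simp
  also have "\<dots> = (1 + \<theta>) powr (- h)"
    by (subst integral_distr) (auto simp: laplace_transform[OF assms(2,3), simplified])
  finally show ?thesis .
qed

text \<open>The reciprocal form of the inequality between the arithmetic and the geometric mean. It
  results from summing the tangent bounds of \<open>ln\<close> at the mean \<mu>, whose linear terms
  cancel.\<close>

lemma inverse_mean_le_prod_powr:
  fixes a :: "nat \<Rightarrow> real"
  assumes k: "0 < k" and a: "\<And>i. i < k \<Longrightarrow> 0 < a i"
  shows "1 / ((\<Sum>i<k. a i) / k) \<le> (\<Prod>i<k. a i powr (- (1 / k)))"
proof -
  define \<mu> where "\<mu> = (\<Sum>i<k. a i) / k"
  have \<mu>: "\<mu> > 0" unfolding \<mu>_def using k a by (intro divide_pos_pos sum_pos) auto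
  have "(\<Sum>i<k. ln (a i)) \<le> (\<Sum>i<k. ln \<mu> + (a i / \<mu> - 1))"
  proof (rule sum_mono)
    fix i assume "i \<in> {..<k}"
    then have "a i > 0" using a by simp
    then show "ln (a i) \<le> ln \<mu> + (a i / \<mu> - 1)"
      using ln_le_minus_one[of "a i / \<mu>"] \<mu> by (simp add: ln_div)
  qed
  also have "\<dots> = k * ln \<mu> + ((\<Sum>i<k. a i) / \<mu> - k)"
    by (simp add: sum.distrib sum_subtractf sum_divide_distrib)
  also have "(\<Sum>i<k. a i) = \<mu> * k" using k by (simp add: \<mu>_def)
  finally have le: "(\<Sum>i<k. ln (a i)) / k \<le> ln \<mu>" using k \<mu> by (simp add: field_simps)
  have "1 / \<mu> = exp (- ln \<mu>)" using \<mu> by (simp add: exp_minus inverse_eq_divide)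
  also have "\<dots> \<le> exp (- ((\<Sum>i<k. ln (a i)) / k))" using le by simp
  also have "\<dots> = (\<Prod>i<k. exp (- (1 / k) * ln (a i)))"
    by (simp add: exp_sum[symmetric] sum_negf sum_divide_distrib)
  also have "\<dots> = (\<Prod>i<k. a i powr (- (1 / k)))"
    using a by (intro prod.cong refl) (simp add: powr_def less_imp_neq[symmetric])
  finally show ?thesis by (simp add: \<mu>_def)
qed

text \<open>
  The independent increments over a partition of \<open>{s<..s + 1}\<close> into \<open>k\<close> equal parts have Laplace
  transform \<open>(1 + \<theta>) powr (- 1 / k)\<close>, so the inequality of the means applies to their product. Since
  \<open>f\<close> increases, right-endpoint sums dominate the integral.
\<close>

lemma (in gamma_process) laplace_integral_ge_half:
  assumes f: "mono_on {0..} f" "\<And>x. 0 \<le> x \<Longrightarrow> 0 \<le> f x" and s: "0 \<le> s"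
    and d: "0 < lebesgue_int f (s + 1) - lebesgue_int f s" (is "0 < ?d")
  shows "1 / 2 \<le> expectation (\<lambda>\<omega>. exp (- ((stieltjes_int S f (s + 1) \<omega> - stieltjes_int S f s \<omega>) / ?d)))"
proof -
  define Y where "Y \<omega> = stieltjes_int S f (s + 1) \<omega> - stieltjes_int S f s \<omega>" for \<omega>
  have f1: "mono_on {0..} (\<lambda>x. 1 * f x)" using f(1) by simp
  have [measurable]: "Y \<in> borel_measurable M"
    unfolding Y_def[abs_def] by (intro borel_measurable_diff measurable_stieltjes_int[OF f1 _ f(2)]) auto
  \<comment> \<open>With \<open>k\<close> parts the mean of the numbers \<open>1 + a i\<close> is at
    most \<open>2\<close> plus a discretisation error of order \<open>1 / k\<close>. Letting
    \<open>k\<close> tend to infinity leaves \<open>1 / 2\<close>.\<close>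
  have bound: "1 / (2 + (f (s + 1) - f s) / ?d / k) \<le> expectation (\<lambda>\<omega>. exp (- (Y \<omega> / ?d)))"
    if k: "0 < k" for k :: nat
  proof -
    define \<tau> where "\<tau> i = s + real i / real k" for i
    have \<tau>: "0 \<le> \<tau> i" "\<tau> i \<le> \<tau> (Suc i)" "\<tau> 0 = s" "\<tau> k = s + 1" for i
      using s k by (auto simp: \<tau>_def divide_right_mono)
    have step: "\<tau> (Suc i) = \<tau> i + 1 / k" for i by (simp add: \<tau>_def add_divide_distrib)
    define a where "a i = f (\<tau> (Suc i)) / ?d" for i
    have a: "0 \<le> a i" for i using f(2) \<tau>(1) d by (simp add: a_def)
    define Z where "Z \<omega> = (\<Sum>i<k. a i * (S (\<tau> (Suc i)) \<omega> - S (\<tau> i) \<omega>))" for \<omega>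
    have S_meas [measurable]: "S (\<tau> i) \<in> borel_measurable M" for i using \<tau> by (intro random_variable)
    have [measurable]: "Z \<in> borel_measurable M" by (simp add: Z_def[abs_def])
    have incr: "0 \<le> S (\<tau> (Suc i)) \<omega> - S (\<tau> i) \<omega>" if "\<omega> \<in> space M" for i \<omega>
      using mono_onD[OF increasing[OF that], of "\<tau> i" "\<tau> (Suc i)"] \<tau> by simp
    have YZ: "0 \<le> Y \<omega>" "Y \<omega> / ?d \<le> Z \<omega>" if \<omega>: "\<omega> \<in> space M" for \<omega>
    proof -
      interpret nondecreasing_integrator "\<lambda>s. S (max 0 s) \<omega>" using \<omega> by (rule path_integrator)
      have Y: "Y \<omega> = (LINT x:{s<..s + 1}|interval_measure (\<lambda>s. S (max 0 s) \<omega>). f x)"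
        using integral_Ioc_combine[OF f1, of 0 s "s + 1"] s by (simp add: Y_def stieltjes_int_def)
      show "0 \<le> Y \<omega>"
        using integral_Ioc_nondecreasing[OF f1 _ f(2), of s "s + 1"] s by (simp add: Y_def stieltjes_int_def)
      have "Y \<omega> \<le> (\<Sum>i<k. f (\<tau> (Suc i)) * (S (\<tau> (Suc i)) \<omega> - S (\<tau> i) \<omega>))"
        using riemann_sum_bounds(1)[OF f1, of \<tau> k] \<tau> s by (simp add: Y)
      then have "Y \<omega> / ?d \<le> (\<Sum>i<k. f (\<tau> (Suc i)) * (S (\<tau> (Suc i)) \<omega> - S (\<tau> i) \<omega>)) / ?d"
        by (rule divide_right_mono) (use d in simp)
      then show "Y \<omega> / ?d \<le> Z \<omega>" by (simp add: Z_def a_def sum_divide_distrib)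
    qed
    have mean: "(\<Sum>i<k. 1 + a i) / k \<le> 2 + (f (s + 1) - f s) / ?d / k"
    proof -
      interpret nondecreasing_integrator "\<lambda>x. x" by (rule nondecreasing_integrator_id)
      have "?d = (LINT x:{s<..s + 1}|interval_measure (\<lambda>x. x). f x)"
        using integral_Ioc_combine[OF f1, of 0 s "s + 1"] s by (simp add: lebesgue_int_eq_interval_measure)
      then have "(\<Sum>i<k. f (\<tau> i) * (1 / k)) \<le> ?d"
        using riemann_sum_bounds(2)[OF f1, of \<tau> k] \<tau> s by (simp add: step)
      then have "(\<Sum>i<k. f (\<tau> i)) / k \<le> ?d" by (simp add: sum_divide_distrib)
      \<comment> \<open>Right and left endpoint sums differ by a telescoping sum, and the left one
        divided by \<open>k\<close> is at most the increment \<open>?d\<close>.\<close>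
      moreover have "(\<Sum>i<k. f (\<tau> (Suc i))) = (\<Sum>i<k. f (\<tau> i)) + (f (s + 1) - f s)"
        using sum_lessThan_telescope[of "\<lambda>i. f (\<tau> i)" k] \<tau> by (simp add: sum_subtractf)
      ultimately have "(\<Sum>i<k. f (\<tau> (Suc i))) / k \<le> ?d + (f (s + 1) - f s) / k"
        by (simp add: add_divide_distrib)
      then have "(\<Sum>i<k. f (\<tau> (Suc i))) / k / ?d \<le> (?d + (f (s + 1) - f s) / k) / ?d"
        using d by (intro divide_right_mono) auto
      also have "\<dots> = 1 + (f (s + 1) - f s) / ?d / k" using d k by (simp add: field_simps)
      finally have "(\<Sum>i<k. a i) / k \<le> 1 + (f (s + 1) - f s) / ?d / k"
        by (simp add: a_def sum_divide_distrib[symmetric] mult.commute)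
      then show ?thesis using k by (simp add: sum.distrib add_divide_distrib)
    qed
    have pos: "0 < (\<Sum>i<k. 1 + a i) / k"
      using k a by (intro divide_pos_pos sum_pos) (auto intro: add_pos_nonneg)
    have "1 / (2 + (f (s + 1) - f s) / ?d / k) \<le> 1 / ((\<Sum>i<k. 1 + a i) / k)"
      by (rule divide_left_mono[OF mean _ mult_pos_pos[OF less_le_trans[OF pos mean] pos]]) simp
    also have "\<dots> \<le> (\<Prod>i<k. (1 + a i) powr (- (1 / k)))"
      by (rule inverse_mean_le_prod_powr[OF k]) (simp add: a add_pos_nonneg)
    also have "\<dots> = (\<Prod>i<k. expectation (\<lambda>\<omega>. exp (- a i * (S (\<tau> (Suc i)) \<omega> - S (\<tau> i) \<omega>))))"
      using \<tau>(1) a laplace_increment[of "\<tau> _" "1 / k" "a _"] by (intro prod.cong) (simp_all add: step)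
    also have "\<dots> = expectation (\<lambda>\<omega>. \<Prod>i<k. exp (- a i * (S (\<tau> (Suc i)) \<omega> - S (\<tau> i) \<omega>)))"
    proof (rule indep_vars_lebesgue_integral[symmetric])
      have "indep_vars (\<lambda>_. borel) (\<lambda>i \<omega>. S (\<tau> (Suc i)) \<omega> - S (\<tau> i) \<omega>) {..<k}"
        by (rule indep_increments) (use s in \<open>auto intro!: mono_onI simp: \<tau>_def divide_right_mono\<close>)
      then show "indep_vars (\<lambda>_. borel) (\<lambda>i \<omega>. exp (- a i * (S (\<tau> (Suc i)) \<omega> - S (\<tau> i) \<omega>))) {..<k}"
        by (rule indep_vars_compose2[where X="\<lambda>i \<omega>. S (\<tau> (Suc i)) \<omega> - S (\<tau> i) \<omega>"]) measurable
      show "integrable M (\<lambda>\<omega>. exp (- a i * (S (\<tau> (Suc i)) \<omega> - S (\<tau> i) \<omega>)))" for i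
        using incr a by (intro integrable_const_bound[where B=1] AE_I2) auto
    qed simp
    also have "(\<lambda>\<omega>. \<Prod>i<k. exp (- a i * (S (\<tau> (Suc i)) \<omega> - S (\<tau> i) \<omega>))) = (\<lambda>\<omega>. exp (- Z \<omega>))"
      by (simp add: exp_sum[symmetric] Z_def sum_negf)
    also have "expectation (\<lambda>\<omega>. exp (- Z \<omega>)) \<le> expectation (\<lambda>\<omega>. exp (- (Y \<omega> / ?d)))"
    proof (rule integral_mono)
      have Y0: "0 \<le> Y \<omega> / ?d" if "\<omega> \<in> space M" for \<omega> using YZ(1)[OF that] d by simp
      then show "integrable M (\<lambda>\<omega>. exp (- (Y \<omega> / ?d)))"
        by (intro integrable_const_bound[where B=1] AE_I2) auto
      have "0 \<le> Z \<omega>" if "\<omega> \<in> space M" for \<omega> using YZ(2)[OF that] Y0[OF that] by linarith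
      then show "integrable M (\<lambda>\<omega>. exp (- Z \<omega>))"
        by (intro integrable_const_bound[where B=1] AE_I2) auto
    qed (use YZ(2) in simp)
    finally show ?thesis .
  qed
  have "(\<lambda>k. 1 / (2 + (f (s + 1) - f s) / ?d / real k)) \<longlonglongrightarrow> 1 / (2 + 0)"
    by (intro tendsto_intros real_tendsto_divide_at_top[OF tendsto_const] filterlim_real_sequentially) auto
  then have "1 / (2 + 0) \<le> expectation (\<lambda>\<omega>. exp (- (Y \<omega> / ?d)))"
    by (rule tendsto_upperbound) (use bound in \<open>auto intro!: eventually_sequentiallyI[of 1]\<close>)
  then show ?thesis by (simp add: Y_def)
qed

section \<open>The equivalence for a fixed mode and direction of monotonicity\<close>

lemma (in gamma_process) converges_stieltjes_iff_weighted_sum: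
  fixes f :: "real \<Rightarrow> real" and \<sigma> :: real
  assumes m: "valid_mode m" and \<sigma>: "\<sigma> = 1 \<or> \<sigma> = - 1"
    and f: "mono_on {0..} (\<lambda>x. \<sigma> * f x)" "\<And>x. 0 \<le> x \<Longrightarrow> 0 \<le> f x"
    and diverges: "filterlim (lebesgue_int f) at_top at_top"
  shows "converges m M (\<lambda>t \<omega>. stieltjes_int S f t \<omega> / lebesgue_int f t) 1 at_top \<longleftrightarrow>
    converges m M (\<lambda>n \<omega>. (\<Sum>i<n. f (real (Suc i)) * (S (real (Suc i)) \<omega> - S (real i) \<omega>))
      / (\<Sum>i<n. f (real (Suc i)))) 1 sequentially"
proof -
  \<comment> \<open>Indices start at \<open>0\<close>: \<open>D i\<close> and \<open>v i\<close> are
    the increment and the weight with number \<open>i + 1\<close> in the usual counting.\<close>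
  define D where "D i \<omega> = S (real (Suc i)) \<omega> - S (real i) \<omega>" for i \<omega>
  define v where "v i = f (real (Suc i))" for i
  define A where "A = stieltjes_int S f"
  define lam where "lam = lebesgue_int f"
  define B where "B n \<omega> = (\<Sum>i<n. v i * D i \<omega>)" for n \<omega>
  define B' where "B' n \<omega> = (\<Sum>i<n. v i * D (Suc i) \<omega>)" for n \<omega>
  define W where "W n = (\<Sum>i<n. v i)" for n
  define U where "U \<omega> = (if \<sigma> = 1 then 0 else f 0 * D 0 \<omega>)" for \<omega>
  have \<sigma>0: "\<sigma> \<noteq> 0" "\<bar>\<sigma>\<bar> = 1" using \<sigma> by auto
  have f_incr: "f x \<le> f y" if "\<sigma> = 1" "0 \<le> x" "x \<le> y" for x y
    using mono_onD[OF f(1), of x y] that by simp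
  have f_decr: "f y \<le> f x" if "\<sigma> = - 1" "0 \<le> x" "x \<le> y" for x y
    using mono_onD[OF f(1), of x y] that by simp
  have v: "0 \<le> v i" for i by (simp add: v_def f(2))
  have [measurable]: "D i \<in> borel_measurable M" for i
    unfolding D_def[abs_def] by (intro borel_measurable_diff random_variable) auto
  have D: "0 \<le> D i \<omega>" if "\<omega> \<in> space M" for i \<omega>
    using mono_onD[OF increasing[OF that], of "real i" "real (Suc i)"] by (simp add: D_def)
  have [measurable]: "A t \<in> borel_measurable M" for t
    unfolding A_def by (rule measurable_stieltjes_int[OF f(1) \<sigma>0(1) f(2)])
  have [measurable]: "B n \<in> borel_measurable M" "B' n \<in> borel_measurable M" "U \<in> borel_measurable M" for n
    by (simp_all add: B_def[abs_def] B'_def[abs_def] U_def[abs_def])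
  have A_mono: "A s \<omega> \<le> A t \<omega>" if \<omega>: "\<omega> \<in> space M" and "0 \<le> s" "s \<le> t" for \<omega> s t
  proof -
    interpret nondecreasing_integrator "\<lambda>s. S (max 0 s) \<omega>" using \<omega> by (rule path_integrator)
    show ?thesis
      using integral_Ioc_nondecreasing[OF f(1) \<sigma>0(1) f(2) that(2,3)] by (simp add: A_def stieltjes_int_def)
  qed
  have lam_mono: "lam s \<le> lam t" if "0 \<le> s" "s \<le> t" for s t
  proof -
    interpret nondecreasing_integrator "\<lambda>x. x" by (rule nondecreasing_integrator_id)
    show ?thesis
      using integral_Ioc_nondecreasing[OF f(1) \<sigma>0(1) f(2) that]
      by (simp add: lam_def lebesgue_int_eq_interval_measure)
  qed
  have AB: "\<sigma> * A (real n) \<omega> \<le> \<sigma> * B n \<omega>"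
      "\<sigma> * (f 0 * D 0 \<omega> + B' n \<omega>) \<le> \<sigma> * A (real (Suc n)) \<omega>" if \<omega>: "\<omega> \<in> space M" for n \<omega>
  proof -
    interpret nondecreasing_integrator "\<lambda>s. S (max 0 s) \<omega>" using \<omega> by (rule path_integrator)
    show "\<sigma> * A (real n) \<omega> \<le> \<sigma> * B n \<omega>"
      using riemann_sum_bounds(1)[OF f(1) \<sigma>0(1), of real n]
      by (simp add: A_def B_def v_def D_def stieltjes_int_def)
    \<comment> \<open>Once the first term is split off the left endpoint sum, the weight
      \<open>v i\<close> meets the increment \<open>D (Suc i)\<close>, which is how
      \<open>B'\<close> arises.\<close>
    have "(\<Sum>i<Suc n. f (real i) * D i \<omega>) = f 0 * D 0 \<omega> + B' n \<omega>"
      unfolding sum.lessThan_Suc_shift by (simp add: B'_def v_def)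
    then show "\<sigma> * (f 0 * D 0 \<omega> + B' n \<omega>) \<le> \<sigma> * A (real (Suc n)) \<omega>"
      using riemann_sum_bounds(2)[OF f(1) \<sigma>0(1), of real "Suc n"]
      by (simp add: A_def D_def stieltjes_int_def del: sum.lessThan_Suc)
  qed
  have lam_W: "\<sigma> * lam (real n) \<le> \<sigma> * W n" "\<sigma> * (f 0 + W n) \<le> \<sigma> * lam (real (Suc n))" for n
  proof -
    interpret nondecreasing_integrator "\<lambda>x. x" by (rule nondecreasing_integrator_id)
    show "\<sigma> * lam (real n) \<le> \<sigma> * W n"
      using riemann_sum_bounds(1)[OF f(1) \<sigma>0(1), of real n]
      by (simp add: lam_def W_def v_def lebesgue_int_eq_interval_measure)
    have "(\<Sum>i<Suc n. f (real i)) = f 0 + W n"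
      unfolding sum.lessThan_Suc_shift by (simp add: W_def v_def)
    then show "\<sigma> * (f 0 + W n) \<le> \<sigma> * lam (real (Suc n))"
      using riemann_sum_bounds(2)[OF f(1) \<sigma>0(1), of real "Suc n"]
      by (simp add: lam_def lebesgue_int_eq_interval_measure del: sum.lessThan_Suc)
  qed
  have lam_n: "filterlim (\<lambda>n. lam (real n)) at_top sequentially"
    unfolding lam_def by (rule filterlim_compose[OF diverges filterlim_real_sequentially])
  have W_top: "filterlim W at_top sequentially"
  proof (rule filterlim_at_top_mono)
    show "filterlim (\<lambda>n. - f 0 + lam (real n)) at_top sequentially"
      by (rule filterlim_tendsto_add_at_top[OF tendsto_const lam_n])
    have "- f 0 + lam (real n) \<le> W n" for n
      using \<sigma> lam_W[of n] f(2)[of 0] lam_mono[of "real n" "real (Suc n)"] by auto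
    then show "\<forall>\<^sub>F n in sequentially. - f 0 + lam (real n) \<le> W n" by simp
  qed
  have U_bound: "\<exists>K. \<forall>n \<omega>. 1 \<le> n \<longrightarrow> \<omega> \<in> space M \<longrightarrow> U \<omega> \<le> K * A (real n) \<omega> \<and> U \<omega> \<le> K * B n \<omega>"
  proof (cases "\<sigma> = 1")
    case True
    then show ?thesis by (intro exI[of _ 0]) (simp add: U_def)
  next
    case False
    then have \<sigma>: "\<sigma> = - 1" using \<sigma> by simp
    \<comment> \<open>This positivity makes \<open>U\<close> the multiple \<open>f 0 / f 1\<close>
      of the first summand of \<open>B\<close>, so \<open>K = f 0 / f 1\<close> works. If
      \<open>f 1\<close> were \<open>0\<close>, a decreasing \<open>f\<close> would leave only zero
      weights, although \<open>W\<close> diverges.\<close>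
    have "0 < f 1"
    proof (rule ccontr)
      assume "\<not> 0 < f 1"
      then have "v i = 0" for i
        using f_decr[OF \<sigma>, of 1 "real (Suc i)"] f(2)[of "real (Suc i)"] by (simp add: v_def)
      then have "W n = 0" for n by (simp add: W_def)
      moreover have "\<forall>\<^sub>F n in sequentially. W n > 0" using W_top by (simp add: filterlim_at_top_dense)
      ultimately show False by simp
    qed
    have "U \<omega> \<le> f 0 / f 1 * A (real n) \<omega> \<and> U \<omega> \<le> f 0 / f 1 * B n \<omega>" if n: "1 \<le> n" and \<omega>: "\<omega> \<in> space M" for n \<omega>
    proof -
      have "f 1 * D 0 \<omega> \<le> B n \<omega>"
        using member_le_sum[of 0 "{..<n}" "\<lambda>i. v i * D i \<omega>"] n D[OF \<omega>] v by (simp add: B_def v_def)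
      moreover have "B n \<omega> \<le> A (real n) \<omega>" using AB(1)[OF \<omega>, of n] \<sigma> by simp
      moreover have "U \<omega> = f 0 / f 1 * (f 1 * D 0 \<omega>)" using \<open>0 < f 1\<close> False by (simp add: U_def)
      moreover have "0 \<le> f 0 / f 1" using f(2) by simp
      ultimately show ?thesis by (metis mult_left_mono order_trans)
    qed
    then show ?thesis by blast
  qed
  then obtain K where K: "\<And>n \<omega>. 1 \<le> n \<Longrightarrow> \<omega> \<in> space M \<Longrightarrow> U \<omega> \<le> K * A (real n) \<omega>"
      "\<And>n \<omega>. 1 \<le> n \<Longrightarrow> \<omega> \<in> space M \<Longrightarrow> U \<omega> \<le> K * B n \<omega>" by blast
  have W_Suc: "W (Suc n) = W n + v n" for n by (simp add: W_def)
  have "converges m M (\<lambda>t \<omega>. A t \<omega> / lam t) 1 at_top \<longleftrightarrow>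
    converges m M (\<lambda>n \<omega>. B n \<omega> / W n) 1 sequentially"
  proof (rule converges_iff_sandwich[where \<sigma>=\<sigma> and \<kappa>="f 0" and U=U and K=K and B'=B', OF m \<sigma>0(2)])
    show "\<sigma> * W n \<le> \<sigma> * lam (real (Suc n)) + f 0" for n
      using lam_W(2)[of n] \<sigma> f(2)[of 0] by auto
    show "\<sigma> * B' n \<omega> \<le> \<sigma> * A (real (Suc n)) \<omega> + U \<omega>" if "\<omega> \<in> space M" for n \<omega>
      using AB(2)[OF that, of n] \<sigma> mult_nonneg_nonneg[OF f(2)[of 0] D[OF that, of 0]]
      by (auto simp: U_def)
    show "vanishes m M (excess \<tau> B W) sequentially \<longleftrightarrow> vanishes m M (excess \<tau> B' W) sequentially" for \<tau>
      using vanishes_weighted_sum_shift[of m \<tau> v W] by (simp add: B_def[abs_def] B'_def[abs_def] D_def)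
    show "(\<lambda>n. lam (real n) / lam (real (Suc n))) \<longlonglongrightarrow> 1"
      if conv: "converges m M (\<lambda>n \<omega>. A (real n) \<omega> / lam (real n)) 1 sequentially"
      using \<sigma>
    proof
      assume \<sigma>: "\<sigma> = 1"
      then have f1: "mono_on {0..} f" using f(1) by simp
      show ?thesis
      proof (rule normaliser_ratio_tendsto_1[OF m conv _ lam_n])
        fix n assume "lam (real n) < lam (real (Suc n))"
        then show "1 / 2 \<le> expectation (\<lambda>\<omega>. exp (- ((A (real (Suc n)) \<omega> - A (real n) \<omega>)
            / (lam (real (Suc n)) - lam (real n)))))"
          using laplace_integral_ge_half[OF f1 f(2), of "real n"] by (simp add: A_def lam_def add.commute)
      qed (auto intro: A_mono lam_mono)
    next
      assume \<sigma>: "\<sigma> = - 1"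
      \<comment> \<open>For \<sigma> = -1, \<open>lam_W\<close> says that
        \<open>W n \<le> lam (real n)\<close> and
        \<open>lam (real (Suc n)) \<le> f 0 + W n\<close>.\<close>
      have "\<bar>lam (real (Suc n)) - lam (real n)\<bar> \<le> f 0" for n
        using lam_W[of n] lam_mono[of "real n" "real (Suc n)"] \<sigma> by auto
      then have "(\<lambda>n. lam (real (Suc n)) / lam (real n)) \<longlonglongrightarrow> 1"
        by (intro ratio_tendsto_1_if_bounded_difference[OF lam_n, of _ "f 0"]) auto
      then show ?thesis by (rule ratio_inverse_tendsto_1)
    qed
    show "(\<lambda>n. W n / W (Suc n)) \<longlonglongrightarrow> 1" if conv: "converges m M (\<lambda>n \<omega>. B n \<omega> / W n) 1 sequentially"
      using \<sigma>
    proof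
      assume \<sigma>: "\<sigma> = 1"
      show ?thesis
      proof (rule normaliser_ratio_tendsto_1[OF m conv _ W_top])
        fix n assume "W n < W (Suc n)"
        \<comment> \<open>The normalised increment is a single increment of \<open>S\<close> over
          unit time, whose Laplace transform at \<open>1\<close> is exactly
          \<open>1 / 2\<close>.\<close>
        then have "(B (Suc n) \<omega> - B n \<omega>) / (W (Suc n) - W n) = D n \<omega>" for \<omega>
          by (simp add: B_def W_Suc)
        then show "1 / 2 \<le> expectation (\<lambda>\<omega>. exp (- ((B (Suc n) \<omega> - B n \<omega>) / (W (Suc n) - W n))))"
          using laplace_increment[of "real n" 1 1] by (simp add: D_def add.commute powr_minus_divide)
      qed (auto simp: W_Suc v B_def D)
    next
      assume \<sigma>: "\<sigma> = - 1"
      have "\<bar>W (Suc n) - W n\<bar> \<le> f 0" for n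
        using f_decr[OF \<sigma>, of 0 "real (Suc n)"] v[of n] by (simp add: W_Suc v_def)
      then have "(\<lambda>n. W (Suc n) / W n) \<longlonglongrightarrow> 1"
        by (intro ratio_tendsto_1_if_bounded_difference[OF W_top, of _ "f 0"]) auto
      then show ?thesis by (rule ratio_inverse_tendsto_1)
    qed
    show "0 \<le> U \<omega>" if "\<omega> \<in> space M" for \<omega>
      using f(2)[of 0] D[OF that, of 0] by (simp add: U_def)
    show "W n \<le> W (Suc n)" for n by (simp add: W_Suc v)
    show "filterlim lam at_top at_top" using diverges by (simp add: lam_def)
  qed (use A_mono lam_mono lam_W(1) AB(1) K f(2)[of 0] in auto)
  then show ?thesis by (simp add: A_def lam_def B_def[abs_def] W_def[abs_def] D_def v_def)
qed

theorem theorem1p3: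
  fixes M :: "'a measure" and S :: "real \<Rightarrow> 'a \<Rightarrow> real"
    and f :: "real \<Rightarrow> real"
    and X :: "nat \<Rightarrow> 'a \<Rightarrow> real" and w W :: "nat \<Rightarrow> real"
  assumes gamma: "gamma_process M S"
    and nonneg: "\<And>x. 0 \<le> x \<Longrightarrow> 0 \<le> f x"
    and monotonic: "mono_on {0..} f \<or> antimono_on {0..} f"
    and diverges: "filterlim (lebesgue_int f) at_top at_top"
    and X: "\<And>k \<omega>. 1 \<le> k \<Longrightarrow> X k \<omega> = S (real k) \<omega> - S (real k - 1) \<omega>"
    and w: "\<And>k. 1 \<le> k \<Longrightarrow> w k = f (real k)"
    and W: "\<And>n. W n = (\<Sum>k=1..n. w k)"
  shows
    "(converges_AE M (\<lambda>t \<omega>. stieltjes_int S f t \<omega> / lebesgue_int f t) 1 at_top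
        \<longleftrightarrow> converges_AE M (\<lambda>n \<omega>. (\<Sum>k=1..n. w k * X k \<omega>) / W n) 1 sequentially)
   \<and> (converges_in_prob M (\<lambda>t \<omega>. stieltjes_int S f t \<omega> / lebesgue_int f t) 1 at_top
        \<longleftrightarrow> converges_in_prob M (\<lambda>n \<omega>. (\<Sum>k=1..n. w k * X k \<omega>) / W n) 1 sequentially)
   \<and> (\<forall>p>0. converges_Lp p M (\<lambda>t \<omega>. stieltjes_int S f t \<omega> / lebesgue_int f t) 1 at_top
        \<longleftrightarrow> converges_Lp p M (\<lambda>n \<omega>. (\<Sum>k=1..n. w k * X k \<omega>) / W n) 1 sequentially)"
proof -
  interpret gamma_process M S by (rule gamma)
  \<comment> \<open>The sign makes \<open>\<sigma> * f\<close> increasing in either case; a function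
    that is both increasing and decreasing receives the sign \<open>1\<close>.\<close>
  define \<sigma> :: real where "\<sigma> = (if mono_on {0..} f then 1 else - 1)"
  have \<sigma>: "\<sigma> = 1 \<or> \<sigma> = - 1" by (simp add: \<sigma>_def)
  have f: "mono_on {0..} (\<lambda>x. \<sigma> * f x)"
    using monotonic by (auto simp: \<sigma>_def monotone_on_def)
  have WX: "W n = (\<Sum>i<n. f (real (Suc i)))"
    "(\<Sum>k=1..n. w k * X k \<omega>) = (\<Sum>i<n. f (real (Suc i)) * (S (real (Suc i)) \<omega> - S (real i) \<omega>))" for n \<omega>
    by (simp_all add: W w X sum.atLeast1_atMost_eq)
  have "converges m M (\<lambda>t \<omega>. stieltjes_int S f t \<omega> / lebesgue_int f t) 1 at_top \<longleftrightarrow>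
      converges m M (\<lambda>n \<omega>. (\<Sum>k=1..n. w k * X k \<omega>) / W n) 1 sequentially" if "valid_mode m" for m
    unfolding WX by (rule converges_stieltjes_iff_weighted_sum[OF that \<sigma> f nonneg diverges])
  from this[of Almost_Surely] this[of In_Prob] this[of "In_Lp _"] show ?thesis by simp
qed

end
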